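(* Let $\mathcal{A}$ be any abelian category with enough injectives. Let $\mathcal{I}$ denote the class of all injective objects of $\mathcal{A}$ and $\mathcal{GI}$ the class of all Gorenstein injective objects of $\mathcal{A}$. (1) For any injective cotorsion pair $(\mathcal{W},\mathcal{F})$ in $\mathcal{A}$ we have $\mathcal{I}\subseteq\mathcal{F}\subseteq\mathcal{GI}$. (2) Whenever $({}^{\perp}\mathcal{GI},\mathcal{GI})$ is a complete cotorsion pair, it is automatically an injective cotorsion pair.
   Context: An object $M$ of $\mathcal{A}$ is Gorenstein injective if $M=Z_0J$ (the $0$-th cycle object) for some exact complex $J$ of injective objects such that $\operatorname{Hom}_{\mathcal{A}}(I,J)$ is exact for every injective object $I$. A pair $(\mathcal{X},\mathcal{Y})$ of classes of objects of $\mathcal{A}$ is a cotorsion pair if $\mathcal{Y}=\mathcal{X}^{\perp}:=\{Y:\operatorname{Ext}^1_{\mathcal{A}}(X,Y)=0\ \forall X\in\mathcal{X}\}$ and $\mathcal{X}={}^{\perp}\mathcal{Y}:=\{X:\operatorname{Ext}^1_{\mathcal{A}}(X,Y)=0\ \forall Y\in\mathcal{Y}\}$. It is complete if for every object $A$ there are short exact sequences $0\to Y\to X\to A\to 0$ and $0\to A\to Y'\to X'\to 0$ with $X,X'\in\mathcal{X}$, $Y,Y'\in\mathcal{Y}$. A class is thick if it is closed under direct summands and whenever two of the three terms of a short exact sequence lie in it, so does the third. An injective cotorsion pair is a complete cotorsion pair $(\mathcal{W},\mathcal{F})$ with $\mathcal{W}$ thick and $\mathcal{W}\cap\mathcal{F}$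 equal to the class of injective objects. *)

theory Defs
  imports "HOL-Algebra.Group"
begin

text \<open>
  A category enriched with an addition of parallel arrows is given by its set of objects, its set
  of arrows with domain and codomain, identities, composition (\<open>g \<cdot>\<^bsub>C\<^esub> f\<close> is ``first \<open>f\<close>, then \<open>g\<close>''),
  addition of parallel arrows, and zero arrows. ``Classes of objects'' are subsets of \<open>Obj C\<close>.
\<close>

record ('o, 'm) additive_data =
  Obj :: "'o set"
  Arr :: "'m set"
  Dom :: "'m \<Rightarrow> 'o"
  Cod :: "'m \<Rightarrow> 'o"
  Ident :: "'o \<Rightarrow> 'm"
  Comp :: "'m \<Rightarrow> 'm \<Rightarrow> 'm"  (infixl "\<cdot>\<index>" 70)
  Plus :: "'m \<Rightarrow> 'm \<Rightarrow> 'm"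
  Zero :: "'o \<Rightarrow> 'o \<Rightarrow> 'm"

definition Hom :: "('o, 'm) additive_data \<Rightarrow> 'o \<Rightarrow> 'o \<Rightarrow> 'm set" where
  "Hom C A B = {f \<in> Arr C. Dom C f = A \<and> Cod C f = B}"

definition hom_group :: "('o, 'm) additive_data \<Rightarrow> 'o \<Rightarrow> 'o \<Rightarrow> 'm monoid" where
  "hom_group C A B = \<lparr>carrier = Hom C A B, mult = Plus C, one = Zero C A B\<rparr>"


subsection \<open>Notions needed to define abelian categories\<close>

definition monic :: "('o, 'm) additive_data \<Rightarrow> 'm \<Rightarrow> bool" where
  "monic C f \<longleftrightarrow> f \<in> Arr C \<and>
     (\<forall>A \<in> Obj C. \<forall>u \<in> Hom C A (Dom C f). \<forall>v \<in> Hom C A (Dom C f).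
        f \<cdot>\<^bsub>C\<^esub> u = f \<cdot>\<^bsub>C\<^esub> v \<longrightarrow> u = v)"

definition epic :: "('o, 'm) additive_data \<Rightarrow> 'm \<Rightarrow> bool" where
  "epic C f \<longleftrightarrow> f \<in> Arr C \<and>
     (\<forall>A \<in> Obj C. \<forall>u \<in> Hom C (Cod C f) A. \<forall>v \<in> Hom C (Cod C f) A.
        u \<cdot>\<^bsub>C\<^esub> f = v \<cdot>\<^bsub>C\<^esub> f \<longrightarrow> u = v)"

definition iso_arrow :: "('o, 'm) additive_data \<Rightarrow> 'm \<Rightarrow> bool" where
  "iso_arrow C f \<longleftrightarrow> f \<in> Arr C \<and>
     (\<exists>g \<in> Hom C (Cod C f) (Dom C f).
        g \<cdot>\<^bsub>C\<^esub> f = Ident C (Dom C f) \<and> f \<cdot>\<^bsub>C\<^esub> g = Ident C (Cod C f))"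

definition zero_object :: "('o, 'm) additive_data \<Rightarrow> 'o \<Rightarrow> bool" where
  "zero_object C Z \<longleftrightarrow> Z \<in> Obj C \<and>
     (\<forall>A \<in> Obj C. (\<exists>!f. f \<in> Hom C Z A) \<and> (\<exists>!f. f \<in> Hom C A Z))"

text \<open>Kernels, cokernels, images and biproducts are determined only up to isomorphism, so they are
  predicates: \<open>is_kernel C f k\<close> says that the arrow \<open>k\<close> is a kernel of \<open>f\<close>.\<close>

definition is_kernel :: "('o, 'm) additive_data \<Rightarrow> 'm \<Rightarrow> 'm \<Rightarrow> bool" where
  "is_kernel C f k \<longleftrightarrow> f \<in> Arr C \<and> k \<in> Arr C \<and> Cod C k = Dom C f \<and>
     f \<cdot>\<^bsub>C\<^esub> k = Zero C (Dom C k) (Cod C f) \<and>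
     (\<forall>A \<in> Obj C. \<forall>h \<in> Hom C A (Dom C f). f \<cdot>\<^bsub>C\<^esub> h = Zero C A (Cod C f) \<longrightarrow>
        (\<exists>!u. u \<in> Hom C A (Dom C k) \<and> k \<cdot>\<^bsub>C\<^esub> u = h))"

definition is_cokernel :: "('o, 'm) additive_data \<Rightarrow> 'm \<Rightarrow> 'm \<Rightarrow> bool" where
  "is_cokernel C f c \<longleftrightarrow> f \<in> Arr C \<and> c \<in> Arr C \<and> Dom C c = Cod C f \<and>
     c \<cdot>\<^bsub>C\<^esub> f = Zero C (Dom C f) (Cod C c) \<and>
     (\<forall>A \<in> Obj C. \<forall>h \<in> Hom C (Cod C f) A. h \<cdot>\<^bsub>C\<^esub> f = Zero C (Dom C f) A \<longrightarrow>
        (\<exists>!u. u \<in> Hom C (Cod C c) A \<and> u \<cdot>\<^bsub>C\<^esub> c = h))"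

definition is_biproduct ::
    "('o, 'm) additive_data \<Rightarrow> 'o \<Rightarrow> 'o \<Rightarrow> 'o \<Rightarrow> 'm \<Rightarrow> 'm \<Rightarrow> 'm \<Rightarrow> 'm \<Rightarrow> bool" where
  "is_biproduct C A B S i j p q \<longleftrightarrow>
     i \<in> Hom C A S \<and> j \<in> Hom C B S \<and> p \<in> Hom C S A \<and> q \<in> Hom C S B \<and>
     p \<cdot>\<^bsub>C\<^esub> i = Ident C A \<and> q \<cdot>\<^bsub>C\<^esub> j = Ident C B \<and>
     q \<cdot>\<^bsub>C\<^esub> i = Zero C A B \<and> p \<cdot>\<^bsub>C\<^esub> j = Zero C B A \<and>
     Plus C (i \<cdot>\<^bsub>C\<^esub> p) (j \<cdot>\<^bsub>C\<^esub> q) = Ident C S"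


subsection \<open>Abelian categories\<close>

locale preadditive_category =
  fixes C :: "('o, 'm) additive_data"  (structure)
  assumes dom_obj: "f \<in> Arr C \<Longrightarrow> Dom C f \<in> Obj C"
    and cod_obj: "f \<in> Arr C \<Longrightarrow> Cod C f \<in> Obj C"
    and id_hom: "A \<in> Obj C \<Longrightarrow> Ident C A \<in> Hom C A A"
    and comp_hom: "\<lbrakk>f \<in> Hom C A B; g \<in> Hom C B D\<rbrakk> \<Longrightarrow> g \<cdot> f \<in> Hom C A D"
    and comp_assoc: "\<lbrakk>f \<in> Hom C A B; g \<in> Hom C B D; h \<in> Hom C D E\<rbrakk>
                       \<Longrightarrow> h \<cdot> (g \<cdot> f) = (h \<cdot> g) \<cdot> f"
    and comp_id_right: "f \<in> Hom C A B \<Longrightarrow> f \<cdot> Ident C A = f"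
    and comp_id_left: "f \<in> Hom C A B \<Longrightarrow> Ident C B \<cdot> f = f"
    and hom_comm_group: "\<lbrakk>A \<in> Obj C; B \<in> Obj C\<rbrakk> \<Longrightarrow> comm_group (hom_group C A B)"
    and comp_plus_right: "\<lbrakk>f \<in> Hom C A B; g \<in> Hom C A B; h \<in> Hom C B D\<rbrakk>
                       \<Longrightarrow> h \<cdot> Plus C f g = Plus C (h \<cdot> f) (h \<cdot> g)"
    and comp_plus_left: "\<lbrakk>f \<in> Hom C A B; g \<in> Hom C B D; h \<in> Hom C B D\<rbrakk>
                       \<Longrightarrow> Plus C g h \<cdot> f = Plus C (g \<cdot> f) (h \<cdot> f)"

locale abelian_category = preadditive_category +
  assumes zero_ex: "\<exists>Z. zero_object C Z"
    and biproduct_ex: "\<lbrakk>A \<in> Obj C; B \<in> Obj C\<rbrakk> \<Longrightarrow> \<exists>S i j p q. is_biproduct C A B S i j p q"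
    and kernel_ex: "f \<in> Arr C \<Longrightarrow> \<exists>k. is_kernel C f k"
    and cokernel_ex: "f \<in> Arr C \<Longrightarrow> \<exists>c. is_cokernel C f c"
    and monic_normal: "monic C f \<Longrightarrow> \<exists>g. is_kernel C g f"
    and epic_normal: "epic C f \<Longrightarrow> \<exists>g. is_cokernel C g f"


subsection \<open>Exactness and the Yoneda \<open>Ext\<^sup>1\<close>\<close>

definition is_image :: "('o, 'm) additive_data \<Rightarrow> 'm \<Rightarrow> 'm \<Rightarrow> bool" where
  "is_image C f k \<longleftrightarrow> (\<exists>c. is_cokernel C f c \<and> is_kernel C c k)"

text \<open>\<open>exact_at C f g\<close>: the image of \<open>f\<close> and the kernel of \<open>g\<close> are the same subobject.\<close>

definition exact_at :: "('o, 'm) additive_data \<Rightarrow> 'm \<Rightarrow> 'm \<Rightarrow> bool" where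
  "exact_at C f g \<longleftrightarrow> (\<exists>k. is_image C f k \<and> is_kernel C g k)"

definition short_exact :: "('o, 'm) additive_data \<Rightarrow> 'm \<Rightarrow> 'm \<Rightarrow> bool" where
  "short_exact C f g \<longleftrightarrow> (\<exists>Z. zero_object C Z \<and>
     exact_at C (Zero C Z (Dom C f)) f \<and> exact_at C f g \<and> exact_at C g (Zero C (Cod C g) Z))"

text \<open>An extension of \<open>X\<close> by \<open>Y\<close> is a short exact sequence \<open>0 \<rightarrow> Y \<rightarrow> E \<rightarrow> X \<rightarrow> 0\<close>, given as its pair
  of arrows.\<close>

definition extensions :: "('o, 'm) additive_data \<Rightarrow> 'o \<Rightarrow> 'o \<Rightarrow> ('m \<times> 'm) set" where
  "extensions C X Y = {(f, g). short_exact C f g \<and> Dom C f = Y \<and> Cod C g = X}"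

definition ext_equiv :: "('o, 'm) additive_data \<Rightarrow> 'o \<Rightarrow> 'o \<Rightarrow> (('m \<times> 'm) \<times> ('m \<times> 'm)) set" where
  "ext_equiv C X Y = {((f, g), (f', g')).
     (f, g) \<in> extensions C X Y \<and> (f', g') \<in> extensions C X Y \<and>
     (\<exists>\<phi> \<in> Hom C (Cod C f) (Cod C f'). iso_arrow C \<phi> \<and> \<phi> \<cdot>\<^bsub>C\<^esub> f = f' \<and> g' \<cdot>\<^bsub>C\<^esub> \<phi> = g)}"

lemma (in preadditive_category) equiv_ext_equiv:
  "equiv (extensions C X Y) (ext_equiv C X Y)" 
proof -
  have E: "f \<in> Arr C \<and> g \<in> Arr C \<and> Dom C g = Cod C f" if "(f,g) \<in> extensions C X Y" for f g
    using that by (auto simp: extensions_def short_exact_def exact_at_def is_image_def is_kernel_def is_cokernel_def)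
  have r: "refl_on (extensions C X Y) (ext_equiv C X Y)"
  proof (rule refl_onI; clarify)
    fix f g assume fg: "(f,g) \<in> extensions C X Y"
    have "Ident C (Cod C f) \<in> Hom C (Cod C f) (Cod C f)" using E[OF fg] cod_obj id_hom by blast
    moreover have "iso_arrow C (Ident C (Cod C f))" unfolding iso_arrow_def using calculation comp_id_left[OF calculation] by (auto simp: Hom_def intro!: exI[of _ "Ident C (Cod C f)"])
    moreover have "Ident C (Cod C f) \<cdot> f = f" "g \<cdot> Ident C (Cod C f) = g" using E[OF fg] comp_id_left[of f "Dom C f" "Cod C f"] comp_id_right[of g "Cod C f" "Cod C g"] by (auto simp: Hom_def)
    ultimately show "((f,g),(f,g)) \<in> ext_equiv C X Y" using fg unfolding ext_equiv_def by auto
  qed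
  have s: "sym (ext_equiv C X Y)"
  proof (rule symI; clarify)
    fix f g f' g' assume "((f,g),(f',g')) \<in> ext_equiv C X Y"
    then obtain u v where h: "(f,g) \<in> extensions C X Y" "(f',g') \<in> extensions C X Y"
      "u \<in> Hom C (Cod C f) (Cod C f')" "u \<cdot> f = f'" "g' \<cdot> u = g" "v \<in> Hom C (Cod C f') (Cod C f)"
      "v \<cdot> u = Ident C (Cod C f)" "u \<cdot> v = Ident C (Cod C f')"
      unfolding ext_equiv_def iso_arrow_def by (auto simp: Hom_def)
    have "f \<in> Hom C (Dom C f) (Cod C f)" "g' \<in> Hom C (Cod C f') (Cod C g')" using E h by (auto simp: Hom_def)
    then have "v \<cdot> f' = f" "g \<cdot> v = g'" using h comp_assoc comp_id_left comp_id_right by metis+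
    moreover have "iso_arrow C v" using h unfolding iso_arrow_def by (auto simp: Hom_def)
    ultimately show "((f',g'),(f,g)) \<in> ext_equiv C X Y" using h unfolding ext_equiv_def by auto
  qed
  have t: "trans (ext_equiv C X Y)"
  proof (rule transI; clarify)
    fix f g f' g' f'' g'' assume a: "((f,g),(f',g')) \<in> ext_equiv C X Y" "((f',g'),(f'',g'')) \<in> ext_equiv C X Y"
    from a(1) obtain u v where h: "(f,g) \<in> extensions C X Y" "(f',g') \<in> extensions C X Y"
      "u \<in> Hom C (Cod C f) (Cod C f')" "u \<cdot> f = f'" "g' \<cdot> u = g" "v \<in> Hom C (Cod C f') (Cod C f)"
      "v \<cdot> u = Ident C (Cod C f)" "u \<cdot> v = Ident C (Cod C f')"
      unfolding ext_equiv_def iso_arrow_def by (auto simp: Hom_def)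
    from a(2) obtain u' v' where h': "(f'',g'') \<in> extensions C X Y"
      "u' \<in> Hom C (Cod C f') (Cod C f'')" "u' \<cdot> f' = f''" "g'' \<cdot> u' = g'" "v' \<in> Hom C (Cod C f'') (Cod C f')"
      "v' \<cdot> u' = Ident C (Cod C f')" "u' \<cdot> v' = Ident C (Cod C f'')"
      unfolding ext_equiv_def iso_arrow_def by (auto simp: Hom_def)
    have fg: "f \<in> Hom C (Dom C f) (Cod C f)" "g'' \<in> Hom C (Cod C f'') (Cod C g'')" using E h h' by (auto simp: Hom_def)
    have w: "u' \<cdot> u \<in> Hom C (Cod C f) (Cod C f'')" "v \<cdot> v' \<in> Hom C (Cod C f'') (Cod C f)" using h h' comp_hom by blast+
    have "(v \<cdot> v') \<cdot> (u' \<cdot> u) = v \<cdot> (v' \<cdot> (u' \<cdot> u))" using comp_assoc[OF w(1) h'(5) h(6)] by simp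
    also have "v' \<cdot> (u' \<cdot> u) = u" using comp_assoc[OF h(3) h'(2) h'(5)] h' comp_id_left[OF h(3)] by simp
    finally have 1: "(v \<cdot> v') \<cdot> (u' \<cdot> u) = Ident C (Cod C f)" using h by simp
    have "(u' \<cdot> u) \<cdot> (v \<cdot> v') = u' \<cdot> (u \<cdot> (v \<cdot> v'))" using comp_assoc[OF w(2) h(3) h'(2)] by simp
    also have "u \<cdot> (v \<cdot> v') = v'" using comp_assoc[OF h'(5) h(6) h(3)] h comp_id_left[OF h'(5)] by simp
    finally have 2: "(u' \<cdot> u) \<cdot> (v \<cdot> v') = Ident C (Cod C f'')" using h' by simp
    have "iso_arrow C (u' \<cdot> u)" unfolding iso_arrow_def using w 1 2 by (auto simp: Hom_def)
    moreover have "(u' \<cdot> u) \<cdot> f = f''" "g'' \<cdot> (u' \<cdot> u) = g" using comp_assoc[OF fg(1) h(3) h'(2)] comp_assoc[OF h(3) h'(2) fg(2)] h h' by simp_all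
    ultimately show "((f,g),(f'',g'')) \<in> ext_equiv C X Y" using h h' w unfolding ext_equiv_def by auto
  qed
  have "ext_equiv C X Y \<subseteq> extensions C X Y \<times> extensions C X Y" by (auto simp: ext_equiv_def)
  then show ?thesis using r s t by (auto simp: equiv_def)
qed

definition Ext1 :: "('o, 'm) additive_data \<Rightarrow> 'o \<Rightarrow> 'o \<Rightarrow> ('m \<times> 'm) set set" where
  "Ext1 C X Y = extensions C X Y // ext_equiv C X Y"

text \<open>\<open>Ext1\<close> is only the underlying set of the Yoneda group, without the Baer sum; a group is zero
  iff its underlying set has exactly one element.\<close>

definition Ext1_zero :: "('o, 'm) additive_data \<Rightarrow> 'o \<Rightarrow> 'o \<Rightarrow> bool" where
  "Ext1_zero C X Y \<longleftrightarrow> is_singleton (Ext1 C X Y)"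


subsection \<open>Injective and Gorenstein injective objects\<close>

definition injectives :: "('o, 'm) additive_data \<Rightarrow> 'o set" where
  "injectives C = {I \<in> Obj C. \<forall>m f. monic C m \<longrightarrow> f \<in> Hom C (Dom C m) I \<longrightarrow>
     (\<exists>g \<in> Hom C (Cod C m) I. g \<cdot>\<^bsub>C\<^esub> m = f)}"

definition enough_injectives :: "('o, 'm) additive_data \<Rightarrow> bool" where
  "enough_injectives C \<longleftrightarrow>
     (\<forall>A \<in> Obj C. \<exists>I \<in> injectives C. \<exists>m \<in> Hom C A I. monic C m)"

text \<open>Complexes are homologically graded: \<open>d n : J n \<rightarrow> J (n - 1)\<close>. For an exact sequence of arrows
  the condition that consecutive composites vanish is part of \<open>exact_at\<close>.\<close>

definition exact_complex :: "('o, 'm) additive_data \<Rightarrow> (int \<Rightarrow> 'o) \<Rightarrow> (int \<Rightarrow> 'm) \<Rightarrow> bool" where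
  "exact_complex C J d \<longleftrightarrow>
     (\<forall>n. J n \<in> Obj C \<and> d n \<in> Hom C (J n) (J (n - 1)) \<and> exact_at C (d (n + 1)) (d n))"

text \<open>Exactness of the complex of abelian groups \<open>Hom(I, J)\<close>: in each degree, cycles equal
  boundaries.\<close>

definition Hom_exact :: "('o, 'm) additive_data \<Rightarrow> 'o \<Rightarrow> (int \<Rightarrow> 'o) \<Rightarrow> (int \<Rightarrow> 'm) \<Rightarrow> bool" where
  "Hom_exact C I J d \<longleftrightarrow>
     (\<forall>n. {f \<in> Hom C I (J n). d n \<cdot>\<^bsub>C\<^esub> f = Zero C I (J (n - 1))}
        = (\<lambda>g. d (n + 1) \<cdot>\<^bsub>C\<^esub> g) ` Hom C I (J (n + 1)))"

text \<open>\<open>M = Z\<^sub>0 J\<close> is expressed by \<open>M\<close> being the domain of a kernel of \<open>d 0\<close>.\<close>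

definition gorenstein_injectives :: "('o, 'm) additive_data \<Rightarrow> 'o set" where
  "gorenstein_injectives C = {M \<in> Obj C. \<exists>J d.
     exact_complex C J d \<and> (\<forall>n. J n \<in> injectives C) \<and>
     (\<forall>I \<in> injectives C. Hom_exact C I J d) \<and>
     (\<exists>k. is_kernel C (d 0) k \<and> Dom C k = M)}"


subsection \<open>Cotorsion pairs\<close>

definition right_perp :: "('o, 'm) additive_data \<Rightarrow> 'o set \<Rightarrow> 'o set" where
  "right_perp C \<X> = {Y \<in> Obj C. \<forall>X \<in> \<X>. Ext1_zero C X Y}"

definition left_perp :: "('o, 'm) additive_data \<Rightarrow> 'o set \<Rightarrow> 'o set" where
  "left_perp C \<Y> = {X \<in> Obj C. \<forall>Y \<in> \<Y>. Ext1_zero C X Y}"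

definition cotorsion_pair :: "('o, 'm) additive_data \<Rightarrow> 'o set \<Rightarrow> 'o set \<Rightarrow> bool" where
  "cotorsion_pair C \<X> \<Y> \<longleftrightarrow> \<Y> = right_perp C \<X> \<and> \<X> = left_perp C \<Y>"

definition complete_cotorsion_pair :: "('o, 'm) additive_data \<Rightarrow> 'o set \<Rightarrow> 'o set \<Rightarrow> bool" where
  "complete_cotorsion_pair C \<X> \<Y> \<longleftrightarrow> cotorsion_pair C \<X> \<Y> \<and>
     (\<forall>A \<in> Obj C.
        (\<exists>X \<in> \<X>. \<exists>Y \<in> \<Y>. \<exists>f \<in> Hom C Y X. \<exists>g \<in> Hom C X A. short_exact C f g) \<and>
        (\<exists>X' \<in> \<X>. \<exists>Y' \<in> \<Y>. \<exists>f \<in> Hom C A Y'. \<exists>g \<in> Hom C Y' X'. short_exact C f g))"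

definition direct_summand :: "('o, 'm) additive_data \<Rightarrow> 'o \<Rightarrow> 'o \<Rightarrow> bool" where
  "direct_summand C A S \<longleftrightarrow> (\<exists>B \<in> Obj C. \<exists>i j p q. is_biproduct C A B S i j p q)"

definition thick :: "('o, 'm) additive_data \<Rightarrow> 'o set \<Rightarrow> bool" where
  "thick C \<W> \<longleftrightarrow> \<W> \<subseteq> Obj C \<and>
     (\<forall>S \<in> \<W>. \<forall>A \<in> Obj C. direct_summand C A S \<longrightarrow> A \<in> \<W>) \<and>
     (\<forall>K L M f g. f \<in> Hom C K L \<longrightarrow> g \<in> Hom C L M \<longrightarrow> short_exact C f g \<longrightarrow>
        (K \<in> \<W> \<and> L \<in> \<W> \<longrightarrow> M \<in> \<W>) \<and>
        (K \<in> \<W> \<and> M \<in> \<W> \<longrightarrow> L \<in> \<W>) \<and>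
        (L \<in> \<W> \<and> M \<in> \<W> \<longrightarrow> K \<in> \<W>))"

definition injective_cotorsion_pair :: "('o, 'm) additive_data \<Rightarrow> 'o set \<Rightarrow> 'o set \<Rightarrow> bool" where
  "injective_cotorsion_pair C \<W> \<F> \<longleftrightarrow>
     complete_cotorsion_pair C \<W> \<F> \<and> thick C \<W> \<and> \<W> \<inter> \<F> = injectives C"

end

theory Submission
  imports Defs
begin

text \<open>
  Fix an embedding \<open>0 \<rightarrow> Y \<rightarrow> I \<rightarrow> D \<rightarrow> 0\<close> with \<open>I\<close> injective: \<open>Ext\<^sup>1(X, Y) = 0\<close> means that every arrow
  \<open>X \<rightarrow> D\<close> lifts to \<open>I\<close>. This criterion replaces long exact sequences and \<open>Ext\<^sup>2\<close> throughout.

  (1) A class \<open>G\<close> with \<open>Ext\<^sup>1(I, G) = 0\<close> for injective \<open>I\<close>, each member \<open>M\<close> of which lies in short exact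
  sequences \<open>0 \<rightarrow> M \<rightarrow> J \<rightarrow> N \<rightarrow> 0\<close> and \<open>0 \<rightarrow> N' \<rightarrow> J' \<rightarrow> M \<rightarrow> 0\<close> with \<open>J, J'\<close> injective and \<open>N, N'\<close> in \<open>G\<close>,
  consists of Gorenstein injectives: splice these sequences. The class \<open>\<F>\<close> qualifies: on the right,
  \<open>\<F>\<close> contains the cokernel of an embedding of \<open>M\<close> into an injective because \<open>\<W>\<close> is closed under
  kernels of epimorphisms; on the left, take the approximation \<open>0 \<rightarrow> Y \<rightarrow> X \<rightarrow> M \<rightarrow> 0\<close>, where
  \<open>X\<close> is in \<open>\<F>\<close> as an extension and hence in \<open>\<W> \<inter> \<F>\<close>.

  (2) Conversely, every Gorenstein injective object lies in two such sequences. Dimension shifting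
  along them shows that its left orthogonal class is thick, and a Gorenstein injective object \<open>M\<close> in
  that class splits off \<open>J'\<close>.
\<close>

section \<open>Arithmetic of parallel arrows\<close>

context preadditive_category
begin

lemma hom_obj:
  assumes "f \<in> Hom C A B"
  shows "A \<in> Obj C" "B \<in> Obj C"
  using assms dom_obj cod_obj by (auto simp: Hom_def)

lemma hom_arr: "f \<in> Hom C A B \<Longrightarrow> f \<in> Arr C \<and> Dom C f = A \<and> Cod C f = B"
  by (simp add: Hom_def)

lemma zero_hom: "A \<in> Obj C \<Longrightarrow> B \<in> Obj C \<Longrightarrow> Zero C A B \<in> Hom C A B"
  using monoid.one_closed[of "hom_group C A B"] comm_group.axioms(1)[OF hom_comm_group]
  by (fastforce simp: hom_group_def comm_monoid_def)

text \<open>The enrichment supplies only a sum and a zero, so negatives come from the hom group;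
  reading that group off the second arrow keeps subtraction binary.\<close>

definition diff :: "'m \<Rightarrow> 'm \<Rightarrow> 'm" where
  "diff f g = Plus C f (inv\<^bsub>hom_group C (Dom C g) (Cod C g)\<^esub> g)"

lemma hom_group_group:
  assumes "A \<in> Obj C" "B \<in> Obj C"
  shows "group (hom_group C A B)"
  using hom_comm_group[OF assms] by (simp add: comm_group_def)

lemma plus_hom: "f \<in> Hom C A B \<Longrightarrow> g \<in> Hom C A B \<Longrightarrow> Plus C f g \<in> Hom C A B"
  using monoid.m_closed[OF group.is_monoid[OF hom_group_group], of A B f g] hom_obj[of f A B]
  by (simp add: hom_group_def)

lemma plus_zero_right: "f \<in> Hom C A B \<Longrightarrow> Plus C f (Zero C A B) = f"
  using monoid.r_one[OF group.is_monoid[OF hom_group_group], of A B f] hom_obj[of f A B]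
  by (simp add: hom_group_def)

lemma plus_zero_left: "f \<in> Hom C A B \<Longrightarrow> Plus C (Zero C A B) f = f"
  using monoid.l_one[OF group.is_monoid[OF hom_group_group], of A B f] hom_obj[of f A B]
  by (simp add: hom_group_def)

lemma diff_hom: "f \<in> Hom C A B \<Longrightarrow> g \<in> Hom C A B \<Longrightarrow> diff f g \<in> Hom C A B"
  using group.inv_closed[OF hom_group_group, of A B g] hom_obj[of f A B] hom_arr[of g A B]
  by (simp add: hom_group_def diff_def plus_hom)

lemma diff_plus:
  assumes "f \<in> Hom C A B" "g \<in> Hom C A B"
  shows "Plus C (diff f g) g = f"
proof -
  interpret group "hom_group C A B"
    using hom_group_group hom_obj[OF assms(1)] by blast
  have c: "f \<in> carrier (hom_group C A B)" "g \<in> carrier (hom_group C A B)"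
    using assms by (simp_all add: hom_group_def)
  then have "(f \<otimes>\<^bsub>hom_group C A B\<^esub> inv\<^bsub>hom_group C A B\<^esub> g) \<otimes>\<^bsub>hom_group C A B\<^esub> g = f"
    by (simp add: m_assoc)
  then show ?thesis
    using hom_arr[OF assms(2)] by (simp add: diff_def hom_group_def)
qed

lemma plus_right_cancel:
  assumes "f \<in> Hom C A B" "g \<in> Hom C A B" "h \<in> Hom C A B" "Plus C f h = Plus C g h"
  shows "f = g"
  using group.right_cancel[OF hom_group_group, of A B h f g] assms hom_obj[OF assms(1)]
  by (simp add: hom_group_def)

text \<open>Most rules for subtraction below follow by checking this one equation, without
  calculating with inverses.\<close>

lemma diff_unique:
  assumes "d \<in> Hom C A B" "f \<in> Hom C A B" "g \<in> Hom C A B" "Plus C d g = f"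
  shows "diff f g = d"
  using plus_right_cancel[OF diff_hom assms(1,3)] diff_plus assms by metis

lemma diff_self: "f \<in> Hom C A B \<Longrightarrow> diff f f = Zero C A B"
  using diff_unique[OF zero_hom] plus_zero_left hom_obj by metis

lemma diff_zero: "f \<in> Hom C A B \<Longrightarrow> diff f (Zero C A B) = f"
  using diff_unique[OF _ _ zero_hom] plus_zero_right hom_obj by metis

lemma diff_eq_zeroD:
  "f \<in> Hom C A B \<Longrightarrow> g \<in> Hom C A B \<Longrightarrow> diff f g = Zero C A B \<Longrightarrow> f = g"
  using diff_plus plus_zero_left by metis

lemma comp_diff_right:
  assumes "f \<in> Hom C A B" "g \<in> Hom C A B" "h \<in> Hom C B D"
  shows "h \<cdot> diff f g = diff (h \<cdot> f) (h \<cdot> g)"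
proof (rule sym, rule diff_unique)
  show "Plus C (h \<cdot> diff f g) (h \<cdot> g) = h \<cdot> f"
    using comp_plus_right[OF diff_hom[OF assms(1,2)] assms(2,3)] diff_plus assms by metis
qed (use assms comp_hom diff_hom in blast)+

lemma comp_diff_left:
  assumes "f \<in> Hom C A B" "g \<in> Hom C B D" "h \<in> Hom C B D"
  shows "diff g h \<cdot> f = diff (g \<cdot> f) (h \<cdot> f)"
proof (rule sym, rule diff_unique)
  show "Plus C (diff g h \<cdot> f) (h \<cdot> f) = g \<cdot> f"
    using comp_plus_left[OF assms(1) diff_hom[OF assms(2,3)] assms(3)] diff_plus assms by metis
qed (use assms comp_hom diff_hom in blast)+

text \<open>The axioms make composition additive but do not mention zero arrows. A zero arrow is its
  own difference with itself, so distributivity over \<open>diff\<close> suffices.\<close>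

lemma comp_zero_right:
  assumes "h \<in> Hom C B D" "A \<in> Obj C"
  shows "h \<cdot> Zero C A B = Zero C A D"
proof -
  have z: "Zero C A B \<in> Hom C A B"
    using zero_hom assms hom_obj by blast
  have "h \<cdot> diff (Zero C A B) (Zero C A B) = diff (h \<cdot> Zero C A B) (h \<cdot> Zero C A B)"
    using comp_diff_right[OF z z assms(1)] .
  then show ?thesis
    using diff_self[OF z] diff_self[OF comp_hom[OF z assms(1)]] by simp
qed

lemma comp_zero_left:
  assumes "f \<in> Hom C A B" "D \<in> Obj C"
  shows "Zero C B D \<cdot> f = Zero C A D"
proof -
  have z: "Zero C B D \<in> Hom C B D"
    using zero_hom assms hom_obj by blast
  have "diff (Zero C B D) (Zero C B D) \<cdot> f = diff (Zero C B D \<cdot> f) (Zero C B D \<cdot> f)"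
    using comp_diff_left[OF assms(1) z z] .
  then show ?thesis
    using diff_self[OF z] diff_self[OF comp_hom[OF assms(1) z]] by simp
qed


section \<open>Kernels, cokernels and short exact sequences\<close>

lemma monicD:
  "monic C k \<Longrightarrow> k \<in> Hom C K B \<Longrightarrow> u \<in> Hom C A K \<Longrightarrow> v \<in> Hom C A K \<Longrightarrow> k \<cdot> u = k \<cdot> v \<Longrightarrow> u = v"
  using hom_obj[of u A K] unfolding monic_def by (auto simp: Hom_def)

lemma epicD:
  "epic C k \<Longrightarrow> k \<in> Hom C B K \<Longrightarrow> u \<in> Hom C K A \<Longrightarrow> v \<in> Hom C K A \<Longrightarrow> u \<cdot> k = v \<cdot> k \<Longrightarrow> u = v"
  using hom_obj[of u K A] unfolding epic_def by (auto simp: Hom_def)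

lemma monicD_zero:
  assumes "monic C k" "k \<in> Hom C K B" "u \<in> Hom C A K" "k \<cdot> u = Zero C A B"
  shows "u = Zero C A K"
  using monicD[OF assms(1-3) zero_hom] comp_zero_right[OF assms(2)] assms hom_obj by metis

lemma epicD_zero:
  assumes "epic C k" "k \<in> Hom C B K" "u \<in> Hom C K A" "u \<cdot> k = Zero C B A"
  shows "u = Zero C K A"
  using epicD[OF assms(1-3) zero_hom] comp_zero_left[OF assms(2)] assms hom_obj by metis

text \<open>If \<open>k\<close> identifies \<open>u\<close> and \<open>v\<close>, it kills
  \<open>diff u v\<close>; parallel pairs thus reduce to single arrows killed by
  \<open>k\<close>.\<close>

lemma monicI_zero:
  assumes k: "k \<in> Hom C K B"
    and "\<And>A u. u \<in> Hom C A K \<Longrightarrow> k \<cdot> u = Zero C A B \<Longrightarrow> u = Zero C A K"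
  shows "monic C k"
  unfolding monic_def
proof (intro conjI ballI impI)
  show "k \<in> Arr C"
    using k by (simp add: Hom_def)
next
  fix A u v
  assume *: "u \<in> Hom C A (Dom C k)" "v \<in> Hom C A (Dom C k)" "k \<cdot> u = k \<cdot> v"
  then have uv: "u \<in> Hom C A K" "v \<in> Hom C A K"
    using hom_arr[OF k] by auto
  have "k \<cdot> diff u v = Zero C A B"
    using comp_diff_right[OF uv k] diff_self[OF comp_hom[OF uv(1) k]] * by simp
  then show "u = v"
    using assms(2) diff_eq_zeroD diff_hom uv by blast
qed

lemma epicI_zero:
  assumes k: "k \<in> Hom C B K"
    and "\<And>A u. u \<in> Hom C K A \<Longrightarrow> u \<cdot> k = Zero C B A \<Longrightarrow> u = Zero C K A"
  shows "epic C k"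
  unfolding epic_def
proof (intro conjI ballI impI)
  show "k \<in> Arr C"
    using k by (simp add: Hom_def)
next
  fix A u v
  assume *: "u \<in> Hom C (Cod C k) A" "v \<in> Hom C (Cod C k) A" "u \<cdot> k = v \<cdot> k"
  then have uv: "u \<in> Hom C K A" "v \<in> Hom C K A"
    using hom_arr[OF k] by auto
  have "diff u v \<cdot> k = Zero C B A"
    using comp_diff_left[OF k uv] diff_self[OF comp_hom[OF k uv(1)]] * by simp
  then show "u = v"
    using assms(2) diff_eq_zeroD diff_hom uv by blast
qed

lemma monic_comp:
  assumes "monic C f" "monic C g" "f \<in> Hom C A B" "g \<in> Hom C B D"
  shows "monic C (g \<cdot> f)"
proof (rule monicI_zero[OF comp_hom[OF assms(3,4)]])
  fix T u
  assume u: "u \<in> Hom C T A" "g \<cdot> f \<cdot> u = Zero C T D"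
  then show "u = Zero C T A"
    using monicD_zero[OF assms(2,4) comp_hom[OF u(1) assms(3)]] monicD_zero[OF assms(1,3) u(1)]
      comp_assoc[OF u(1) assms(3,4)] by simp
qed

lemma is_kernelD:
  assumes "is_kernel C f k" "f \<in> Hom C B D"
  shows "k \<in> Hom C (Dom C k) B" "f \<cdot> k = Zero C (Dom C k) D" "monic C k"
    "\<And>A h. h \<in> Hom C A B \<Longrightarrow> f \<cdot> h = Zero C A D \<Longrightarrow> \<exists>u \<in> Hom C A (Dom C k). k \<cdot> u = h"
proof -
  have fD: "Dom C f = B" "Cod C f = D"
    using assms(2) by (auto simp: Hom_def)
  note D = assms(1)[unfolded is_kernel_def fD]
  show k: "k \<in> Hom C (Dom C k) B" and fk: "f \<cdot> k = Zero C (Dom C k) D"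
    using D by (auto simp: Hom_def)
  show "\<And>A h. h \<in> Hom C A B \<Longrightarrow> f \<cdot> h = Zero C A D \<Longrightarrow> \<exists>u \<in> Hom C A (Dom C k). k \<cdot> u = h"
    using D hom_obj by blast
  show "monic C k"
  proof (rule monicI_zero[OF k])
    fix A u
    assume u: "u \<in> Hom C A (Dom C k)" "k \<cdot> u = Zero C A B"
    have A: "A \<in> Obj C" "Dom C k \<in> Obj C" "B \<in> Obj C"
      using hom_obj u k by blast+
    \<comment> \<open>Monicity of a kernel is the uniqueness of the factorization of the zero
      arrow.\<close>
    have "\<exists>!u. u \<in> Hom C A (Dom C k) \<and> k \<cdot> u = Zero C A B"
      using D A zero_hom[of A B] comp_zero_right[OF assms(2)] by blast
    then show "u = Zero C A (Dom C k)"
      using u comp_zero_right[OF k] zero_hom A by blast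
  qed
qed

lemma is_cokernelD:
  assumes "is_cokernel C f k" "f \<in> Hom C D B"
  shows "k \<in> Hom C B (Cod C k)" "k \<cdot> f = Zero C D (Cod C k)" "epic C k"
    "\<And>A h. h \<in> Hom C B A \<Longrightarrow> h \<cdot> f = Zero C D A \<Longrightarrow> \<exists>u \<in> Hom C (Cod C k) A. u \<cdot> k = h"
proof -
  have fD: "Dom C f = D" "Cod C f = B"
    using assms(2) by (auto simp: Hom_def)
  note D = assms(1)[unfolded is_cokernel_def fD]
  show k: "k \<in> Hom C B (Cod C k)" and fk: "k \<cdot> f = Zero C D (Cod C k)"
    using D by (auto simp: Hom_def)
  show "\<And>A h. h \<in> Hom C B A \<Longrightarrow> h \<cdot> f = Zero C D A \<Longrightarrow> \<exists>u \<in> Hom C (Cod C k) A. u \<cdot> k = h"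
    using D hom_obj by blast
  show "epic C k"
  proof (rule epicI_zero[OF k])
    fix A u
    assume u: "u \<in> Hom C (Cod C k) A" "u \<cdot> k = Zero C B A"
    have A: "A \<in> Obj C" "Cod C k \<in> Obj C" "B \<in> Obj C"
      using hom_obj u k by blast+
    have "\<exists>!u. u \<in> Hom C (Cod C k) A \<and> u \<cdot> k = Zero C B A"
      using D A zero_hom[of B A] comp_zero_left[OF assms(2)] by blast
    then show "u = Zero C (Cod C k) A"
      using u comp_zero_left[OF k] zero_hom A by blast
  qed
qed

lemma is_kernelI:
  assumes "f \<in> Hom C B D" "k \<in> Hom C K B" "f \<cdot> k = Zero C K D" "monic C k"
    and "\<And>A h. h \<in> Hom C A B \<Longrightarrow> f \<cdot> h = Zero C A D \<Longrightarrow> \<exists>u \<in> Hom C A K. k \<cdot> u = h"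
  shows "is_kernel C f k"
proof -
  have D: "Dom C f = B" "Cod C f = D" "Dom C k = K" "Cod C k = B" "f \<in> Arr C" "k \<in> Arr C"
    using assms by (auto simp: Hom_def)
  have "\<exists>!u. u \<in> Hom C A K \<and> k \<cdot> u = h" if "h \<in> Hom C A B" "f \<cdot> h = Zero C A D" for A h
    using assms(5)[OF that] monicD[OF assms(4,2)] by metis
  then show ?thesis
    unfolding is_kernel_def D using D assms(3) by simp
qed

lemma is_cokernelI:
  assumes "f \<in> Hom C D B" "k \<in> Hom C B K" "k \<cdot> f = Zero C D K" "epic C k"
    and "\<And>A h. h \<in> Hom C B A \<Longrightarrow> h \<cdot> f = Zero C D A \<Longrightarrow> \<exists>u \<in> Hom C K A. u \<cdot> k = h"
  shows "is_cokernel C f k"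
proof -
  have D: "Dom C f = D" "Cod C f = B" "Dom C k = B" "Cod C k = K" "f \<in> Arr C" "k \<in> Arr C"
    using assms by (auto simp: Hom_def)
  have "\<exists>!u. u \<in> Hom C K A \<and> u \<cdot> k = h" if "h \<in> Hom C B A" "h \<cdot> f = Zero C D A" for A h
    using assms(5)[OF that] epicD[OF assms(4,2)] by metis
  then show ?thesis
    unfolding is_cokernel_def D using D assms(3) by simp
qed

text \<open>Since \<open>m\<close> reflects zero arrows, \<open>f\<close> and
  \<open>m \<cdot> f\<close> kill the same arrows. This and the dual
  \<open>cokernel_comp_epic\<close> identify cycles and boundaries when sequences are
  spliced.\<close>

lemma kernel_comp_monic:
  assumes k: "is_kernel C f k" and f: "f \<in> Hom C A B" and m: "monic C m" "m \<in> Hom C B D"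
  shows "is_kernel C (m \<cdot> f) k"
proof (rule is_kernelI[OF comp_hom[OF f m(2)]])
  note K = is_kernelD[OF k f]
  show "k \<in> Hom C (Dom C k) A" "monic C k"
    by (rule K)+
  show "m \<cdot> f \<cdot> k = Zero C (Dom C k) D"
    using comp_assoc[OF K(1) f m(2)] K(2) comp_zero_right[OF m(2)] hom_obj[OF K(1)] by simp
  fix T h
  assume h: "h \<in> Hom C T A" "m \<cdot> f \<cdot> h = Zero C T D"
  then have "f \<cdot> h = Zero C T B"
    using monicD_zero[OF m comp_hom[OF h(1) f]] comp_assoc[OF h(1) f m(2)] by simp
  then show "\<exists>u \<in> Hom C T (Dom C k). k \<cdot> u = h"
    using K(4) h by blast
qed

lemma cokernel_comp_epic:
  assumes k: "is_cokernel C f k" and f: "f \<in> Hom C A B" and m: "epic C m" "m \<in> Hom C D A"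
  shows "is_cokernel C (f \<cdot> m) k"
proof (rule is_cokernelI[OF comp_hom[OF m(2) f]])
  note K = is_cokernelD[OF k f]
  show "k \<in> Hom C B (Cod C k)" "epic C k"
    by (rule K)+
  show "k \<cdot> (f \<cdot> m) = Zero C D (Cod C k)"
    using comp_assoc[OF m(2) f K(1)] K(2) comp_zero_left[OF m(2)] hom_obj[OF K(1)] by simp
  fix T h
  assume h: "h \<in> Hom C B T" "h \<cdot> (f \<cdot> m) = Zero C D T"
  then have "h \<cdot> f = Zero C A T"
    using epicD_zero[OF m comp_hom[OF f h(1)]] comp_assoc[OF m(2) f h(1)] by simp
  then show "\<exists>u \<in> Hom C (Cod C k) T. u \<cdot> k = h"
    using K(4) h by blast
qed

end

section \<open>Normality and the shape of short exact sequences\<close>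

context abelian_category
begin

text \<open>Normality presents \<open>g\<close> as a cokernel of some \<open>x\<close>, and
  \<open>x\<close> factors through the kernel \<open>k\<close>. Hence whatever kills
  \<open>k\<close> kills \<open>x\<close> and so factors through \<open>g\<close>.\<close>

lemma epic_cokernel_of_kernel:
  assumes g: "epic C g" "g \<in> Hom C B D" and k: "is_kernel C g k"
  shows "is_cokernel C k g"
proof -
  note K = is_kernelD[OF k g(2)]
  obtain x where x: "is_cokernel C x g"
    using epic_normal g by blast
  then have xh: "x \<in> Hom C (Dom C x) B"
    using hom_arr[OF g(2)] by (auto simp: is_cokernel_def Hom_def)
  have gD: "Cod C g = D"
    using g by (simp add: Hom_def)
  note X = is_cokernelD[OF x xh, unfolded gD]
  obtain w where w: "w \<in> Hom C (Dom C x) (Dom C k)" "k \<cdot> w = x"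
    using K(4)[OF xh X(2)] by blast
  show ?thesis
  proof (rule is_cokernelI[OF K(1) g(2) K(2) g(1)])
    fix A h
    assume h: "h \<in> Hom C B A" "h \<cdot> k = Zero C (Dom C k) A"
    have "h \<cdot> x = Zero C (Dom C x) A"
      using comp_assoc[OF w(1) K(1) h(1)] w(2) h comp_zero_left[OF w(1)] hom_obj[OF h(1)] by simp
    then show "\<exists>u \<in> Hom C D A. u \<cdot> g = h"
      using X(4) h(1) by blast
  qed
qed

lemma monic_kernel_of_cokernel:
  assumes g: "monic C g" "g \<in> Hom C D B" and k: "is_cokernel C g k"
  shows "is_kernel C k g"
proof -
  note K = is_cokernelD[OF k g(2)]
  obtain x where x: "is_kernel C x g"
    using monic_normal g by blast
  then have xh: "x \<in> Hom C B (Cod C x)"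
    using hom_arr[OF g(2)] by (auto simp: is_kernel_def Hom_def)
  have gD: "Dom C g = D"
    using g by (simp add: Hom_def)
  note X = is_kernelD[OF x xh, unfolded gD]
  obtain w where w: "w \<in> Hom C (Cod C k) (Cod C x)" "w \<cdot> k = x"
    using K(4)[OF xh X(2)] by blast
  show ?thesis
  proof (rule is_kernelI[OF K(1) g(2) K(2) g(1)])
    fix A h
    assume h: "h \<in> Hom C A B" "k \<cdot> h = Zero C A (Cod C k)"
    have "x \<cdot> h = Zero C A (Cod C x)"
      using comp_assoc[OF h(1) K(1) w(1)] w(2) h comp_zero_right[OF w(1)] hom_obj[OF h(1)] by simp
    then show "\<exists>u \<in> Hom C A D. g \<cdot> u = h"
      using X(4) h(1) by blast
  qed
qed

lemma monic_iff_exact_zero: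
  assumes f: "f \<in> Hom C Y E" and Z: "zero_object C Z"
  shows "exact_at C (Zero C Z Y) f \<longleftrightarrow> monic C f"
proof
  note Y = hom_obj[OF f]
  have zo: "Z \<in> Obj C"
    using Z by (simp add: zero_object_def)
  have z: "Zero C Z Y \<in> Hom C Z Y"
    using zero_hom zo Y by blast
  { assume "exact_at C (Zero C Z Y) f"
    then obtain k c where kc: "is_cokernel C (Zero C Z Y) c" "is_kernel C c k" "is_kernel C f k"
      by (auto simp: exact_at_def is_image_def)
    note Cd = is_cokernelD[OF kc(1) z] and F = is_kernelD[OF kc(3) f]
    note Kd = is_kernelD[OF kc(2) Cd(1)]
    \<comment> \<open>The identity kills the zero arrow, so it factors through the cokernel
      \<open>c\<close>, which gives a left inverse of \<open>c\<close>. As \<open>c\<close> kills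
      \<open>k\<close>, the kernel \<open>k\<close> of \<open>f\<close> is zero.\<close>
    obtain u where u: "u \<in> Hom C (Cod C c) Y" "u \<cdot> c = Ident C Y"
      using Cd(4)[OF id_hom] comp_id_left[OF z] Y by blast
    have k0: "k = Zero C (Dom C k) Y"
      using comp_assoc[OF F(1) Cd(1) u(1)] Kd(2) u comp_id_left[OF F(1)]
        comp_zero_right[OF u(1)] hom_obj[OF F(1)] by simp
    show "monic C f"
    proof (rule monicI_zero[OF f])
      fix A h
      assume h: "h \<in> Hom C A Y" "f \<cdot> h = Zero C A E"
      then obtain v where "v \<in> Hom C A (Dom C k)" "k \<cdot> v = h"
        using F(4) by blast
      then show "h = Zero C A Y"
        using k0 comp_zero_left Y by metis
    qed }
  { assume m: "monic C f"
    have i: "Ident C Y \<in> Hom C Y Y"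
      using id_hom Y by blast
    have zm: "monic C (Zero C Z Y)"
    proof (rule monicI_zero[OF z])
      fix A u
      assume u: "u \<in> Hom C A Z"
      have "A \<in> Obj C"
        using u hom_obj by blast
      then have "\<exists>!f. f \<in> Hom C A Z" "Zero C A Z \<in> Hom C A Z"
        using Z zero_hom[OF _ zo] by (auto simp: zero_object_def)
      then show "u = Zero C A Z"
        using u by blast
    qed
    have fact: "\<exists>u \<in> Hom C A Z. Zero C Z Y \<cdot> u = h" if "h \<in> Hom C A Y" "h = Zero C A Y" for A h
      using that hom_obj[OF that(1)] zero_hom[OF _ zo] comp_zero_left[OF _ Y(1)] by metis
    have c: "is_cokernel C (Zero C Z Y) (Ident C Y)"
    proof (rule is_cokernelI[OF z i])
      show "epic C (Ident C Y)"
        by (rule epicI_zero[OF i]) (simp add: comp_id_right)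
      show "Ident C Y \<cdot> Zero C Z Y = Zero C Z Y"
        by (rule comp_id_left[OF z])
      show "\<And>A h. h \<in> Hom C Y A \<Longrightarrow> \<exists>u \<in> Hom C Y A. u \<cdot> Ident C Y = h"
        using comp_id_right by blast
    qed
    have k: "is_kernel C (Ident C Y) (Zero C Z Y)"
      by (rule is_kernelI[OF i z comp_id_left[OF z] zm]) (use fact comp_id_left in metis)
    have "is_kernel C f (Zero C Z Y)"
      by (rule is_kernelI[OF f z comp_zero_right[OF f zo] zm]) (use fact monicD_zero[OF m f] in metis)
    then show "exact_at C (Zero C Z Y) f"
      using c k by (auto simp: exact_at_def is_image_def) }
qed

lemma epic_iff_exact_zero:
  assumes g: "g \<in> Hom C E X" and Z: "zero_object C Z"
  shows "exact_at C g (Zero C X Z) \<longleftrightarrow> epic C g"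
proof
  note X = hom_obj[OF g]
  have zo: "Z \<in> Obj C"
    using Z by (simp add: zero_object_def)
  have z: "Zero C X Z \<in> Hom C X Z"
    using zero_hom zo X by blast
  have i: "Ident C X \<in> Hom C X X"
    using id_hom X by blast
  { assume "exact_at C g (Zero C X Z)"
    then obtain k c where kc: "is_cokernel C g c" "is_kernel C c k" "is_kernel C (Zero C X Z) k"
      by (auto simp: exact_at_def is_image_def)
    note Cd = is_cokernelD[OF kc(1) g] and F = is_kernelD[OF kc(3) z]
    note Kd = is_kernelD[OF kc(2) Cd(1)]
    obtain v where v: "v \<in> Hom C X (Dom C k)" "k \<cdot> v = Ident C X"
      using F(4)[OF i] comp_id_right[OF z] by blast
    have c0: "c = Zero C X (Cod C c)"
      using comp_assoc[OF v(1) Kd(1) Cd(1)] Kd(2) v comp_id_right[OF Cd(1)]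
        comp_zero_left[OF v(1)] hom_obj[OF Cd(1)] by simp
    show "epic C g"
    proof (rule epicI_zero[OF g])
      fix A h
      assume h: "h \<in> Hom C X A" "h \<cdot> g = Zero C E A"
      then obtain v where "v \<in> Hom C (Cod C c) A" "v \<cdot> c = h"
        using Cd(4) by blast
      then show "h = Zero C X A"
        using c0 comp_zero_right X by metis
    qed }
  { assume m: "epic C g"
    have ze: "epic C (Zero C X Z)"
    proof (rule epicI_zero[OF z])
      fix A u
      assume u: "u \<in> Hom C Z A"
      have "A \<in> Obj C"
        using u hom_obj by blast
      then have "\<exists>!f. f \<in> Hom C Z A" "Zero C Z A \<in> Hom C Z A"
        using Z zero_hom[OF zo] by (auto simp: zero_object_def)
      then show "u = Zero C Z A"
        using u by blast
    qed
    have im: "monic C (Ident C X)"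
      by (rule monicI_zero[OF i]) (simp add: comp_id_left)
    have k: "is_kernel C (Zero C X Z) (Ident C X)"
      by (rule is_kernelI[OF z i comp_id_right[OF z] im]) (use comp_id_left in blast)
    have c: "is_cokernel C g (Zero C X Z)"
    proof (rule is_cokernelI[OF g z comp_zero_left[OF g zo] ze])
      fix A h
      assume h: "h \<in> Hom C X A" "h \<cdot> g = Zero C E A"
      then have "h = Zero C X A"
        using epicD_zero[OF m g] by blast
      then show "\<exists>u \<in> Hom C Z A. u \<cdot> Zero C X Z = h"
        using h hom_obj[OF h(1)] zero_hom[OF zo] comp_zero_right[OF _ X(2)] by metis
    qed
    show "exact_at C g (Zero C X Z)"
      using c k by (auto simp: exact_at_def is_image_def) }
qed

text \<open>\<open>exact_at\<close> only says that some \<open>k\<close> is both an image of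
  \<open>f\<close> and a kernel of \<open>g\<close>. A monic \<open>f\<close> is a kernel of its own
  cokernel, so it is the same subobject as \<open>k\<close> and can replace it as a kernel of
  \<open>g\<close>.\<close>

lemma short_exact_iff:
  assumes f: "f \<in> Hom C Y E" and g: "g \<in> Hom C E X"
  shows "short_exact C f g \<longleftrightarrow> is_kernel C g f \<and> epic C g"
proof
  have D: "Dom C f = Y" "Cod C g = X"
    using f g by (auto simp: Hom_def)
  { assume "short_exact C f g"
    then obtain Z where Z: "zero_object C Z" "exact_at C (Zero C Z Y) f" "exact_at C f g"
        "exact_at C g (Zero C X Z)"
      unfolding short_exact_def D by blast
    have m: "monic C f" and e: "epic C g"
      using Z monic_iff_exact_zero[OF f] epic_iff_exact_zero[OF g] by blast+
    obtain k c where kc: "is_cokernel C f c" "is_kernel C c k" "is_kernel C g k"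
      using Z(3) by (auto simp: exact_at_def is_image_def)
    note Cd = is_cokernelD[OF kc(1) f] and G = is_kernelD[OF kc(3) g]
    note Kd = is_kernelD[OF kc(2) Cd(1)]
    have fc: "is_kernel C c f"
      by (rule monic_kernel_of_cokernel[OF m f kc(1)])
    note Fc = is_kernelD[OF fc Cd(1), unfolded D]
    have "is_kernel C g f"
    proof (rule is_kernelI[OF g f _ m])
      obtain w where w: "w \<in> Hom C Y (Dom C k)" "k \<cdot> w = f"
        using Kd(4)[OF f Cd(2)] by blast
      show "g \<cdot> f = Zero C Y X"
        using comp_assoc[OF w(1) G(1) g] w G(2) comp_zero_left[OF w(1)] hom_obj[OF g] by simp
      fix A h
      assume h: "h \<in> Hom C A E" "g \<cdot> h = Zero C A X"
      then obtain v where v: "v \<in> Hom C A (Dom C k)" "k \<cdot> v = h"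
        using G(4) by blast
      have "c \<cdot> h = Zero C A (Cod C c)"
        using comp_assoc[OF v(1) Kd(1) Cd(1)] v Kd(2) comp_zero_left[OF v(1)] hom_obj[OF Cd(1)]
        by simp
      then show "\<exists>u \<in> Hom C A Y. f \<cdot> u = h"
        using Fc(4) h by blast
    qed
    then show "is_kernel C g f \<and> epic C g"
      using e by blast }
  { assume *: "is_kernel C g f \<and> epic C g"
    then have "is_cokernel C f g" and m: "monic C f"
      using epic_cokernel_of_kernel[OF _ g] is_kernelD[OF _ g] by blast+
    then have e: "exact_at C f g"
      using * by (auto simp: exact_at_def is_image_def)
    obtain Z where "zero_object C Z"
      using zero_ex by blast
    then show "short_exact C f g"
      unfolding short_exact_def D
      using * m e monic_iff_exact_zero[OF f] epic_iff_exact_zero[OF g] by blast }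
qed

definition ses where
  "ses a b Y E X \<longleftrightarrow> a \<in> Hom C Y E \<and> b \<in> Hom C E X \<and> short_exact C a b"

lemma sesI:
  assumes "a \<in> Hom C Y E" "b \<in> Hom C E X" "is_kernel C b a" "epic C b"
  shows "ses a b Y E X"
  using assms short_exact_iff by (simp add: ses_def)

lemma sesD:
  assumes "ses a b Y E X"
  shows "a \<in> Hom C Y E" "b \<in> Hom C E X" "is_kernel C b a" "is_cokernel C a b" "monic C a" "epic C b"
    "b \<cdot> a = Zero C Y X"
    "\<And>A h. h \<in> Hom C A E \<Longrightarrow> b \<cdot> h = Zero C A X \<Longrightarrow> \<exists>u \<in> Hom C A Y. a \<cdot> u = h"
    "\<And>A h. h \<in> Hom C E A \<Longrightarrow> h \<cdot> a = Zero C Y A \<Longrightarrow> \<exists>u \<in> Hom C X A. u \<cdot> b = h"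
proof -
  show a: "a \<in> Hom C Y E" and b: "b \<in> Hom C E X"
    using assms by (auto simp: ses_def)
  have D: "Dom C a = Y" "Cod C b = X"
    using a b by (auto simp: Hom_def)
  show k: "is_kernel C b a" and e: "epic C b"
    using assms short_exact_iff[OF a b] by (auto simp: ses_def)
  show c: "is_cokernel C a b"
    by (rule epic_cokernel_of_kernel[OF e b k])
  show "monic C a" "b \<cdot> a = Zero C Y X"
    "\<And>A h. h \<in> Hom C A E \<Longrightarrow> b \<cdot> h = Zero C A X \<Longrightarrow> \<exists>u \<in> Hom C A Y. a \<cdot> u = h"
    using is_kernelD[OF k b] unfolding D by blast+
  show "\<And>A h. h \<in> Hom C E A \<Longrightarrow> h \<cdot> a = Zero C Y A \<Longrightarrow> \<exists>u \<in> Hom C X A. u \<cdot> b = h"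
    using is_cokernelD[OF c a] unfolding D by blast
qed

lemma extensions_iff: "(a, b) \<in> extensions C X Y \<longleftrightarrow> ses a b Y (Cod C a) X"
proof
  assume *: "(a, b) \<in> extensions C X Y"
  then have "a \<in> Arr C" "b \<in> Arr C" "Dom C b = Cod C a" "Dom C a = Y" "Cod C b = X" "short_exact C a b"
    by (auto simp: extensions_def short_exact_def exact_at_def is_image_def is_kernel_def is_cokernel_def)
  then show "ses a b Y (Cod C a) X"
    by (auto simp: ses_def Hom_def)
next
  assume "ses a b Y (Cod C a) X"
  then show "(a, b) \<in> extensions C X Y"
    by (auto simp: ses_def Hom_def extensions_def)
qed

end


section \<open>Splitting and lifting\<close>

context preadditive_category
begin

text \<open>\<open>comp_assoc\<close> and its companions do not work as rewrite rules because their premises contain objects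
  that do not occur in the conclusion; hence the variants with premises about \<open>Dom\<close> and \<open>Cod\<close>.\<close>

lemma comp_arr:
  assumes "f \<in> Arr C" "g \<in> Arr C" "Dom C g = Cod C f"
  shows "g \<cdot> f \<in> Arr C" "Dom C (g \<cdot> f) = Dom C f" "Cod C (g \<cdot> f) = Cod C g"
  using comp_hom[of f "Dom C f" "Cod C f" g "Cod C g"] assms by (auto simp: Hom_def)

lemma comp_assoc_arr:
  assumes "f \<in> Arr C" "g \<in> Arr C" "h \<in> Arr C" "Dom C g = Cod C f" "Dom C h = Cod C g"
  shows "(h \<cdot> g) \<cdot> f = h \<cdot> (g \<cdot> f)"
  using comp_assoc[of f "Dom C f" "Cod C f" g "Cod C g" h "Cod C h"] assms by (auto simp: Hom_def)

text \<open>\<open>comp_assoc_arr\<close> nests composites to the right; in this form an equation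
  for \<open>h \<cdot> g\<close> still applies when a further arrow follows on the right.\<close>

lemma comp_reduce:
  assumes "h \<cdot> g = k" "f \<in> Arr C" "g \<in> Arr C" "h \<in> Arr C" "Dom C g = Cod C f" "Dom C h = Cod C g"
  shows "h \<cdot> (g \<cdot> f) = k \<cdot> f"
  using comp_assoc_arr[OF assms(2-6)] assms(1) by simp

lemma diff_arr:
  assumes "f \<in> Arr C" "g \<in> Arr C" "Dom C f = Dom C g" "Cod C f = Cod C g"
  shows "diff f g \<in> Arr C" "Dom C (diff f g) = Dom C f" "Cod C (diff f g) = Cod C f"
  using diff_hom[of f "Dom C f" "Cod C f" g] assms by (auto simp: Hom_def)

lemma plus_arr:
  assumes "f \<in> Arr C" "g \<in> Arr C" "Dom C f = Dom C g" "Cod C f = Cod C g"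
  shows "Plus C f g \<in> Arr C" "Dom C (Plus C f g) = Dom C f" "Cod C (Plus C f g) = Cod C f"
  using plus_hom[of f "Dom C f" "Cod C f" g] assms by (auto simp: Hom_def)

lemma zero_arr:
  assumes "A \<in> Obj C" "B \<in> Obj C"
  shows "Zero C A B \<in> Arr C" "Dom C (Zero C A B) = A" "Cod C (Zero C A B) = B"
  using zero_hom[of A B] assms by (auto simp: Hom_def)

lemma id_arr:
  assumes "A \<in> Obj C"
  shows "Ident C A \<in> Arr C" "Dom C (Ident C A) = A" "Cod C (Ident C A) = A"
  using id_hom[of A] assms by (auto simp: Hom_def)

lemma comp_id_arr:
  assumes "f \<in> Arr C"
  shows "Dom C f = A \<Longrightarrow> f \<cdot> Ident C A = f" "Cod C f = A \<Longrightarrow> Ident C A \<cdot> f = f"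
  using assms comp_id_right[of f] comp_id_left[of f] by (auto simp: Hom_def)

lemma comp_zero_arr:
  assumes "f \<in> Arr C"
  shows "Dom C f = B \<Longrightarrow> A \<in> Obj C \<Longrightarrow> f \<cdot> Zero C A B = Zero C A (Cod C f)"
    "Cod C f = A \<Longrightarrow> B \<in> Obj C \<Longrightarrow> Zero C A B \<cdot> f = Zero C (Dom C f) B"
  using assms comp_zero_right[of f B _ A] comp_zero_left[of f _ A B] by (auto simp: Hom_def)

lemma comp_diff_arr:
  assumes "f \<in> Arr C" "g \<in> Arr C" "h \<in> Arr C" "Dom C f = Dom C g" "Cod C f = Cod C g"
  shows "Dom C h = Cod C g \<Longrightarrow> h \<cdot> diff f g = diff (h \<cdot> f) (h \<cdot> g)"
    "Cod C h = Dom C g \<Longrightarrow> diff f g \<cdot> h = diff (f \<cdot> h) (g \<cdot> h)"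
  using assms comp_diff_right[of f "Dom C f" "Cod C f" g h "Cod C h"]
    comp_diff_left[of h "Dom C h" "Dom C f" f "Cod C f" g] by (auto simp: Hom_def)

lemma comp_plus_arr:
  assumes "f \<in> Arr C" "g \<in> Arr C" "h \<in> Arr C" "Dom C f = Dom C g" "Cod C f = Cod C g"
  shows "Dom C h = Cod C g \<Longrightarrow> h \<cdot> Plus C f g = Plus C (h \<cdot> f) (h \<cdot> g)"
    "Cod C h = Dom C g \<Longrightarrow> Plus C f g \<cdot> h = Plus C (f \<cdot> h) (g \<cdot> h)"
  using assms comp_plus_right[of f "Dom C f" "Cod C f" g h "Cod C h"]
    comp_plus_left[of h "Dom C h" "Dom C f" f "Cod C f" g] by (auto simp: Hom_def)

lemma add_zero_arr:
  assumes "f \<in> Arr C" "Dom C f = A" "Cod C f = B"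
  shows "Plus C f (Zero C A B) = f" "Plus C (Zero C A B) f = f" "diff f (Zero C A B) = f"
  using assms plus_zero_right[of f] plus_zero_left[of f] diff_zero[of f] by (auto simp: Hom_def)

lemma diff_self_arr: "f \<in> Arr C \<Longrightarrow> diff f f = Zero C (Dom C f) (Cod C f)"
  using diff_self[of f] by (auto simp: Hom_def)

lemmas arr_simps = comp_arr comp_assoc_arr diff_arr plus_arr zero_arr id_arr comp_id_arr
  comp_zero_arr comp_diff_arr comp_plus_arr add_zero_arr diff_self_arr

lemma homI: "f \<in> Arr C \<Longrightarrow> Dom C f = A \<Longrightarrow> Cod C f = B \<Longrightarrow> f \<in> Hom C A B"
  by (simp add: Hom_def)

lemma epic_comp:
  assumes "epic C f" "epic C g" "f \<in> Hom C A B" "g \<in> Hom C B D"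
  shows "epic C (g \<cdot> f)"
proof (rule epicI_zero[OF comp_hom[OF assms(3,4)]])
  fix T u
  assume u: "u \<in> Hom C D T" "u \<cdot> (g \<cdot> f) = Zero C A T"
  then show "u = Zero C D T"
    using epicD_zero[OF assms(1,3) comp_hom[OF assms(4) u(1)]] epicD_zero[OF assms(2,4) u(1)]
      comp_assoc[OF assms(3,4) u(1)] by simp
qed

end

section \<open>Biproducts, split sequences and the lifting property\<close>

context abelian_category
begin

lemma biproduct_ses:
  assumes "is_biproduct C A B S i j p q"
  shows "ses i q A S B"
proof (rule sesI)
  show h: "i \<in> Hom C A S" "q \<in> Hom C S B"
    using assms by (auto simp: is_biproduct_def)
  have h': "j \<in> Hom C B S" "p \<in> Hom C S A" 
    using assms by (auto simp: is_biproduct_def)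
  note obs = hom_obj[OF h(1)] hom_obj[OF h'(1)]
  note H = hom_arr[OF h(1)] hom_arr[OF h(2)] hom_arr[OF h'(1)] hom_arr[OF h'(2)]
  have e: "p \<cdot> i = Ident C A" "q \<cdot> j = Ident C B" "q \<cdot> i = Zero C A B" "p \<cdot> j = Zero C B A"
    "Plus C (i \<cdot> p) (j \<cdot> q) = Ident C S"
    using assms by (auto simp: is_biproduct_def)
  show "epic C q"
  proof (rule epicI_zero[OF h(2)])
    fix T u assume u: "u \<in> Hom C B T" "u \<cdot> q = Zero C S T"
    then have "u \<cdot> (q \<cdot> j) = Zero C S T \<cdot> j"
      using comp_assoc[OF h'(1) h(2) u(1)] by simp
    then show "u = Zero C B T"
      using H obs e hom_arr[OF u(1)] hom_obj[OF u(1)] by (simp add: arr_simps)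
  qed
  have "monic C i"
  proof (rule monicI_zero[OF h(1)])
    fix T u assume u: "u \<in> Hom C T A" "i \<cdot> u = Zero C T S"
    then have "(p \<cdot> i) \<cdot> u = p \<cdot> Zero C T S"
      using comp_assoc[OF u(1) h(1) h'(2)] by simp
    then show "u = Zero C T A"
      using H obs e hom_arr[OF u(1)] hom_obj[OF u(1)] by (simp add: arr_simps)
  qed
  then show "is_kernel C q i"
  proof (rule is_kernelI[OF h(2,1) e(3)])
    fix T t assume t: "t \<in> Hom C T S" "q \<cdot> t = Zero C T B"
    \<comment> \<open>The identity of \<open>S\<close> decomposes \<open>t\<close> into two
      components; the one through \<open>j\<close> vanishes.\<close>
    have "Plus C (i \<cdot> p) (j \<cdot> q) \<cdot> t = i \<cdot> (p \<cdot> t)"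
      using H obs t(2) hom_arr[OF t(1)] hom_obj[OF t(1)] by (simp add: arr_simps)
    then have "i \<cdot> (p \<cdot> t) = t"
      using e hom_arr[OF t(1)] by (simp add: arr_simps)
    then show "\<exists>u \<in> Hom C T A. i \<cdot> u = t"
      using comp_hom[OF t(1) h'(2)] by blast
  qed
qed

text \<open>The arrow \<open>1 - a r\<close> kills \<open>a\<close>, so it equals \<open>t b\<close>
  for some \<open>t\<close>. Then \<open>b t b = b\<close>, and cancelling the epic \<open>b\<close>
  makes \<open>t\<close> a section.\<close>

lemma section_of_retraction:
  assumes s: "ses a b Y E X" and r: "r \<in> Hom C E Y" "r \<cdot> a = Ident C Y"
  shows "\<exists>s \<in> Hom C X E. b \<cdot> s = Ident C X"
proof -
  note S = sesD[OF s]
  note obs = hom_obj[OF S(1)] hom_obj[OF S(2)]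
  note H = hom_arr[OF S(1)] hom_arr[OF S(2)] hom_arr[OF r(1)]
  have d: "diff (Ident C E) (a \<cdot> r) \<in> Hom C E E"
    using H obs by (intro homI) (simp_all add: arr_simps)
  have "diff (Ident C E) (a \<cdot> r) \<cdot> a = Zero C Y E"
    using H obs r(2) by (simp add: arr_simps)
  then obtain t where t: "t \<in> Hom C X E" "t \<cdot> b = diff (Ident C E) (a \<cdot> r)"
    using S(9)[OF d] by blast
  have "b \<cdot> t \<cdot> b = b \<cdot> diff (Ident C E) (a \<cdot> r)"
    using comp_assoc[OF S(2) t(1) S(2)] t(2) by simp
  also have "\<dots> = Ident C X \<cdot> b"
    using H obs S(7) by (simp add: arr_simps comp_reduce[OF S(7)])
  finally have "b \<cdot> t = Ident C X"
    using epicD[OF S(6,2) comp_hom[OF t(1) S(2)] id_hom] obs by blast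
  then show ?thesis
    using t by blast
qed

text \<open>The section makes \<open>1 - t b\<close> factor as \<open>a r\<close>, and
  \<open>a, t, r, b\<close> form a second biproduct structure, now on \<open>E\<close>. The
  comparison of the two biproducts and its inverse are the explicit arrows \<open>?\<phi>\<close>
  and \<open>?\<psi>\<close>.\<close>

lemma split_ses_equiv_biproduct:
  assumes s: "ses a b Y E X" and t: "t \<in> Hom C X E" "b \<cdot> t = Ident C X"
    and bp: "is_biproduct C Y X S i j p q"
  shows "((i, q), (a, b)) \<in> ext_equiv C X Y"
proof -
  note S = sesD[OF s]
  have h: "i \<in> Hom C Y S" "q \<in> Hom C S X" "j \<in> Hom C X S" "p \<in> Hom C S Y" 
    using bp by (auto simp: is_biproduct_def)
  have e: "p \<cdot> i = Ident C Y" "q \<cdot> j = Ident C X" "q \<cdot> i = Zero C Y X" "p \<cdot> j = Zero C X Y"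
    "Plus C (i \<cdot> p) (j \<cdot> q) = Ident C S"
    using bp by (auto simp: is_biproduct_def)
  note obs = hom_obj[OF S(1)] hom_obj[OF S(2)] hom_obj[OF h(1)]
  note H = hom_arr[OF S(1)] hom_arr[OF S(2)] hom_arr[OF h(1)] hom_arr[OF h(2)] hom_arr[OF h(3)]
    hom_arr[OF h(4)] hom_arr[OF t(1)]
  have d: "diff (Ident C E) (t \<cdot> b) \<in> Hom C E E"
    using H obs by (intro homI) (simp_all add: arr_simps)
  have "b \<cdot> diff (Ident C E) (t \<cdot> b) = Zero C E X"
    using H obs by (simp add: arr_simps comp_reduce[OF t(2)])
  then obtain r where r: "r \<in> Hom C E Y" "a \<cdot> r = diff (Ident C E) (t \<cdot> b)"
    using S(8)[OF d] by blast
  note H = H hom_arr[OF r(1)]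
  have sum: "Plus C (a \<cdot> r) (t \<cdot> b) = Ident C E"
    unfolding r(2) by (rule diff_plus[of _ E E]) (use obs id_hom comp_hom[OF S(2) t(1)] in blast)+
  have "a \<cdot> (r \<cdot> a) = a \<cdot> Ident C Y"
    using H obs S(7) by (simp add: arr_simps comp_reduce[OF r(2)])
  then have ra: "r \<cdot> a = Ident C Y"
    using monicD[OF S(5,1) comp_hom[OF S(1) r(1)] id_hom] obs by blast
  have "a \<cdot> (r \<cdot> t) = a \<cdot> Zero C X Y"
    using H obs t(2) by (simp add: arr_simps comp_reduce[OF r(2)])
  then have rt: "r \<cdot> t = Zero C X Y"
    using monicD[OF S(5,1) comp_hom[OF t(1) r(1)] zero_hom] obs by blast
  let ?\<phi> = "Plus C (a \<cdot> p) (t \<cdot> q)" and ?\<psi> = "Plus C (i \<cdot> r) (j \<cdot> b)"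
  have \<phi>: "?\<phi> \<in> Hom C S E" and \<psi>: "?\<psi> \<in> Hom C E S"
    using H obs by (auto intro!: homI simp: arr_simps)
  have 1: "?\<phi> \<cdot> ?\<psi> = Plus C (a \<cdot> r) (t \<cdot> b)"
    using H obs by (simp add: arr_simps comp_reduce[OF e(1)] comp_reduce[OF e(2)]
        comp_reduce[OF e(3)] comp_reduce[OF e(4)])
  have 2: "?\<psi> \<cdot> ?\<phi> = Plus C (i \<cdot> p) (j \<cdot> q)"
    using H obs by (simp add: arr_simps comp_reduce[OF ra] comp_reduce[OF rt]
        comp_reduce[OF t(2)] comp_reduce[OF S(7)])
  have "iso_arrow C ?\<phi>"
    using \<phi> \<psi> 1 2 e(5) sum hom_arr[OF \<phi>] by (auto simp: iso_arrow_def)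
  moreover have "?\<phi> \<cdot> i = a" "b \<cdot> ?\<phi> = q"
    using H obs by (simp_all add: arr_simps comp_reduce[OF t(2)] comp_reduce[OF S(7)] e)
  moreover have "(i, q) \<in> extensions C X Y" "(a, b) \<in> extensions C X Y"
    using s biproduct_ses[OF bp] H by (simp_all add: extensions_iff)
  ultimately show ?thesis
    using \<phi> H by (auto simp: ext_equiv_def)
qed

text \<open>The biproduct extension always provides one class, so having exactly one class means
  that every extension is equivalent to it. An equivalence carries \<open>j\<close> to a section;
  conversely a section yields an equivalence.\<close>

lemma Ext1_zero_iff:
  assumes X: "X \<in> Obj C" and Y: "Y \<in> Obj C"
  shows "Ext1_zero C X Y \<longleftrightarrow>
    (\<forall>E a b. ses a b Y E X \<longrightarrow> (\<exists>s \<in> Hom C X E. b \<cdot> s = Ident C X))"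
proof -
  obtain S i j p q where bp: "is_biproduct C Y X S i j p q"
    using biproduct_ex[OF Y X] by blast
  have h: "i \<in> Hom C Y S" "q \<in> Hom C S X" "j \<in> Hom C X S" "q \<cdot> j = Ident C X"
    using bp by (auto simp: is_biproduct_def)
  have iq: "(i, q) \<in> extensions C X Y"
    using biproduct_ses[OF bp] hom_arr[OF h(1)] by (simp add: extensions_iff)
  note eq = equiv_ext_equiv[of X Y]
  show ?thesis
  proof (intro iffI allI impI)
    fix E a b
    assume z: "Ext1_zero C X Y" and s: "ses a b Y E X"
    note S = sesD[OF s]
    have ab: "(a, b) \<in> extensions C X Y"
      using s hom_arr[OF S(1)] by (simp add: extensions_iff)
    have "ext_equiv C X Y `` {(i, q)} = ext_equiv C X Y `` {(a, b)}"
      using z quotientI[OF iq, of "ext_equiv C X Y"] quotientI[OF ab, of "ext_equiv C X Y"]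
      by (auto simp: Ext1_zero_def Ext1_def is_singleton_def)
    then have "((i, q), (a, b)) \<in> ext_equiv C X Y"
      using eq_equiv_class[OF _ eq ab] by blast
    then obtain \<phi> where \<phi>: "\<phi> \<in> Hom C S E" "b \<cdot> \<phi> = q"
      using hom_arr[OF h(1)] hom_arr[OF S(1)] by (auto simp: ext_equiv_def)
    have "b \<cdot> (\<phi> \<cdot> j) = Ident C X"
      using comp_assoc[OF h(3) \<phi>(1) S(2)] \<phi>(2) h(4) by simp
    then show "\<exists>s \<in> Hom C X E. b \<cdot> s = Ident C X"
      using comp_hom[OF h(3) \<phi>(1)] by blast
  next
    assume *: "\<forall>E a b. ses a b Y E X \<longrightarrow> (\<exists>s \<in> Hom C X E. b \<cdot> s = Ident C X)"
    have "((i, q), ab) \<in> ext_equiv C X Y" if "ab \<in> extensions C X Y" for ab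
    proof -
      obtain a b where ab: "ab = (a, b)"
        by fastforce
      then have ses: "ses a b Y (Cod C a) X"
        using that extensions_iff by simp
      then obtain t where "t \<in> Hom C X (Cod C a)" "b \<cdot> t = Ident C X"
        using * by blast
      then show ?thesis
        unfolding ab by (rule split_ses_equiv_biproduct[OF ses _ _ bp])
    qed
    then have "Ext1 C X Y = {ext_equiv C X Y `` {(i, q)}}"
      using iq equiv_class_eq[OF eq] by (fastforce simp: Ext1_def quotient_def)
    then show "Ext1_zero C X Y"
      by (simp add: Ext1_zero_def)
  qed
qed

text \<open>The pulled back sequence along \<open>h\<close> splits; the pullback is the kernel of
  \<open>(g, - h) : E \<oplus> X \<rightarrow> D\<close>.\<close>

lemma lift_along_epic:
  assumes s: "ses f g Y E D" and z: "Ext1_zero C X Y" and h: "h \<in> Hom C X D"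
  shows "\<exists>h' \<in> Hom C X E. g \<cdot> h' = h"
proof -
  note S = sesD[OF s]
  have o1: "X \<in> Obj C" "Y \<in> Obj C" "E \<in> Obj C" "D \<in> Obj C"
    using hom_obj S h by blast+
  obtain B i j p q where bp: "is_biproduct C E X B i j p q"
    using biproduct_ex o1 by blast
  have b: "i \<in> Hom C E B" "q \<in> Hom C B X" "j \<in> Hom C X B" "p \<in> Hom C B E" 
    using bp by (auto simp: is_biproduct_def)
  have e: "p \<cdot> i = Ident C E" "q \<cdot> j = Ident C X" "q \<cdot> i = Zero C E X" "p \<cdot> j = Zero C X E"
    "Plus C (i \<cdot> p) (j \<cdot> q) = Ident C B"
    using bp by (auto simp: is_biproduct_def)
  note obs = o1 hom_obj[OF b(1)]
  note H = hom_arr[OF S(1)] hom_arr[OF S(2)] hom_arr[OF h] hom_arr[OF b(1)] hom_arr[OF b(2)]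
    hom_arr[OF b(3)] hom_arr[OF b(4)]
  let ?t = "diff (g \<cdot> p) (h \<cdot> q)"
  have t: "?t \<in> Hom C B D"
    using H obs by (intro homI) (simp_all add: arr_simps)
  have ti: "?t \<cdot> i = g"
    using H obs by (simp add: arr_simps e)
  \<comment> \<open>The restriction of \<open>?t\<close> along \<open>i\<close> is \<open>g\<close>,
    which is already epic.\<close>
  have te: "epic C ?t"
  proof (rule epicI_zero[OF t])
    fix A u assume u: "u \<in> Hom C D A" "u \<cdot> ?t = Zero C B A"
    have "u \<cdot> g = u \<cdot> ?t \<cdot> i"
      using comp_assoc[OF b(1) t u(1)] ti by simp
    also have "\<dots> = Zero C E A"
      using comp_zero_left[OF b(1)] u hom_obj by simp
    finally show "u = Zero C D A"
      using epicD_zero[OF S(6,2) u(1)] by blast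
  qed
  obtain k where k: "is_kernel C ?t k"
    using kernel_ex t hom_arr by blast
  define P where "P = Dom C k"
  note K = is_kernelD[OF k t, folded P_def]
  have kc: "is_cokernel C k ?t"
    by (rule epic_cokernel_of_kernel[OF te t k])
  note KC = is_cokernelD(4)[OF kc K(1)]
  note obs = obs hom_obj[OF K(1)]
  note H = H hom_arr[OF K(1)] hom_arr[OF t]
  have qk: "q \<cdot> k \<in> Hom C P X"
    using K(1) b(2) comp_hom by blast
  \<comment> \<open>Epics are stable under this pullback: if \<open>u\<close> kills
    \<open>q k\<close>, then \<open>u q\<close> factors through \<open>?t\<close> by some
    \<open>w\<close>. Restricting along \<open>i\<close> gives \<open>w g = 0\<close>, so
    \<open>w\<close> vanishes, hence so does \<open>u q\<close>, and restricting along
    \<open>j\<close> so does \<open>u\<close>.\<close>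
  have ep: "epic C (q \<cdot> k)"
  proof (rule epicI_zero[OF qk])
    fix A u assume u: "u \<in> Hom C X A" "u \<cdot> (q \<cdot> k) = Zero C P A"
    note H = H hom_arr[OF u(1)] and obs = obs hom_obj[OF u(1)]
    have "u \<cdot> q \<cdot> k = Zero C P A"
      using u H by (simp add: arr_simps)
    then obtain w where w: "w \<in> Hom C D A" "w \<cdot> ?t = u \<cdot> q"
      using KC[OF comp_hom[OF b(2) u(1)]] H by auto
    have "w \<cdot> g = w \<cdot> ?t \<cdot> i"
      using comp_assoc[OF b(1) t w(1)] ti by simp
    also have "\<dots> = Zero C E A"
      unfolding w(2) using H obs e by (simp add: arr_simps)
    finally have "w = Zero C D A"
      using epicD_zero[OF S(6,2) w(1)] by blast
    then have "u \<cdot> q = Zero C B A"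
      using w(2) comp_zero_left[OF t] obs by simp
    then have "u \<cdot> (q \<cdot> j) = Zero C B A \<cdot> j"
      using comp_assoc[OF b(3,2) u(1)] by simp
    then show "u = Zero C X A"
      using H obs by (simp add: e arr_simps)
  qed
  \<comment> \<open>The kernel of the pulled back epic is again \<open>Y\<close>, embedded in the
    pullback as the pair \<open>(f, 0)\<close>.\<close>
  have "?t \<cdot> (i \<cdot> f) = Zero C Y D"
    using comp_assoc[OF S(1) b(1) t] ti S(7) by simp
  then obtain a where a: "a \<in> Hom C Y P" "k \<cdot> a = i \<cdot> f"
    using K(4)[OF comp_hom[OF S(1) b(1)]] by blast
  note H = H hom_arr[OF a(1)]
  have qka: "q \<cdot> k \<cdot> a = Zero C Y X"
    using H obs by (simp add: arr_simps a(2) comp_reduce[OF e(3)])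
  have am: "monic C a"
  proof (rule monicI_zero[OF a(1)])
    fix A u assume u: "u \<in> Hom C A Y" "a \<cdot> u = Zero C A P"
    note H = H hom_arr[OF u(1)] and obs = obs hom_obj[OF u(1)]
    have "i \<cdot> f \<cdot> u = k \<cdot> Zero C A P"
      unfolding a(2)[symmetric] using H u(2) by (simp add: arr_simps)
    then have "p \<cdot> (i \<cdot> (f \<cdot> u)) = Zero C A E"
      using H obs by (simp add: arr_simps)
    then have "f \<cdot> u = Zero C A E"
      using H obs by (simp add: comp_reduce[OF e(1)] arr_simps)
    then show "u = Zero C A Y"
      using monicD_zero[OF S(5,1) u(1)] by blast
  qed
  have "is_kernel C (q \<cdot> k) a"
  proof (rule is_kernelI[OF qk a(1) qka am])
    fix A x assume x: "x \<in> Hom C A P" "q \<cdot> k \<cdot> x = Zero C A X"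
    note H = H hom_arr[OF x(1)] and obs = obs hom_obj[OF x(1)]
    have qkx: "q \<cdot> (k \<cdot> x) = Zero C A X"
      using x H by (simp add: arr_simps)
    have "Plus C (i \<cdot> p) (j \<cdot> q) \<cdot> (k \<cdot> x) = i \<cdot> (p \<cdot> (k \<cdot> x))"
      using H obs by (simp add: arr_simps qkx)
    then have kx: "k \<cdot> x = i \<cdot> (p \<cdot> (k \<cdot> x))"
      using H obs by (simp add: e arr_simps)
    have "?t \<cdot> (k \<cdot> x) = Zero C A D"
      using comp_assoc[OF x(1) K(1) t] K(2) comp_zero_left[OF x(1)] obs by simp
    then have "g \<cdot> (p \<cdot> (k \<cdot> x)) = Zero C A D"
      using H obs by (simp add: arr_simps qkx)
    then obtain y where y: "y \<in> Hom C A Y" "f \<cdot> y = p \<cdot> (k \<cdot> x)"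
      using S(8)[OF comp_hom[OF comp_hom[OF x(1) K(1)] b(4)]] by blast
    have "k \<cdot> (a \<cdot> y) = i \<cdot> (f \<cdot> y)"
      using H hom_arr[OF y(1)] by (simp add: comp_reduce[OF a(2)] arr_simps)
    then have "a \<cdot> y = x"
      using monicD[OF K(3,1) comp_hom[OF y(1) a(1)] x(1)] y(2) kx by simp
    then show "\<exists>u \<in> Hom C A Y. a \<cdot> u = x"
      using y by blast
  qed
  then have "ses a (q \<cdot> k) Y P X"
    using sesI[OF a(1) qk] ep by blast
  then obtain r where r: "r \<in> Hom C X P" "q \<cdot> k \<cdot> r = Ident C X"
    using z Ext1_zero_iff[OF o1(1,2)] by blast
  note H = H hom_arr[OF r(1)]
  have qkr: "q \<cdot> (k \<cdot> r) = Ident C X"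
    using r H by (simp add: arr_simps)
  \<comment> \<open>The section \<open>r\<close> has the identity as its component in
    \<open>X\<close>; since \<open>?t\<close> vanishes on the pullback, its component in
    \<open>E\<close> is the desired lift.\<close>
  have "?t \<cdot> (k \<cdot> r) = Zero C X D"
    using comp_assoc[OF r(1) K(1) t] K(2) comp_zero_left[OF r(1)] obs by simp
  then have "diff (g \<cdot> (p \<cdot> (k \<cdot> r))) h = Zero C X D"
    using H obs by (simp add: arr_simps qkr)
  moreover have pkr: "p \<cdot> (k \<cdot> r) \<in> Hom C X E"
    using comp_hom r(1) K(1) b(4) by blast
  ultimately have "g \<cdot> (p \<cdot> (k \<cdot> r)) = h"
    using diff_eq_zeroD[OF comp_hom[OF pkr S(2)] h] by blast
  then show ?thesis
    using pkr by blast
qed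

end


section \<open>Vanishing of Ext and injective embeddings\<close>

context abelian_category
begin

lemma injectivesD:
  assumes "I \<in> injectives C" "monic C m" "m \<in> Hom C A B" "f \<in> Hom C A I"
  shows "\<exists>g \<in> Hom C B I. g \<cdot> m = f"
  using assms by (auto simp: injectives_def Hom_def)

lemma injectives_obj: "I \<in> injectives C \<Longrightarrow> I \<in> Obj C"
  by (simp add: injectives_def)

lemma injective_retract:
  assumes I: "I \<in> injectives C" and s: "s \<in> Hom C M I" "p \<in> Hom C I M" "p \<cdot> s = Ident C M"
  shows "M \<in> injectives C"
proof -
  have "\<exists>g \<in> Hom C (Cod C m) M. g \<cdot> m = f" if m: "monic C m" and f: "f \<in> Hom C (Dom C m) M" for m f
  proof -
    have mh: "m \<in> Hom C (Dom C m) (Cod C m)"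
      using m by (simp add: monic_def Hom_def)
    obtain g where g: "g \<in> Hom C (Cod C m) I" "g \<cdot> m = s \<cdot> f"
      using injectivesD[OF I m mh comp_hom[OF f s(1)]] by blast
    have "p \<cdot> g \<cdot> m = f"
      using comp_assoc[OF mh g(1) s(2)] comp_assoc[OF f s(1,2)] g(2) s(3) comp_id_left[OF f] by simp
    then show ?thesis
      using comp_hom[OF g(1) s(2)] by blast
  qed
  then show ?thesis
    using hom_obj[OF s(1)] by (auto simp: injectives_def)
qed

lemma enough_injectives_ses:
  assumes "enough_injectives C" "Y \<in> Obj C"
  obtains I D f g where "I \<in> injectives C" "ses f g Y I D"
proof -
  obtain I f where I: "I \<in> injectives C" and f: "f \<in> Hom C Y I" "monic C f"
    using assms unfolding enough_injectives_def by blast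
  obtain g where g: "is_cokernel C f g"
    using cokernel_ex f hom_arr by blast
  note G = is_cokernelD[OF g f(1)]
  have "ses f g Y I (Cod C g)"
    by (rule sesI[OF f(1) G(1) monic_kernel_of_cokernel[OF f(2,1) g] G(3)])
  then show ?thesis
    using I that by blast
qed

text \<open>Converse of \<open>lift_along_epic\<close> for an injective middle term. Extending
  \<open>f\<close> over an extension \<open>E\<close> gives \<open>e : E -> I\<close> and an induced
  \<open>t : X -> D\<close>; after a lift of \<open>t\<close> is subtracted, \<open>e\<close> lands
  in \<open>Y\<close> and is a retraction.\<close>

lemma Ext1_zeroI_lift:
  assumes s: "ses f g Y I D" and I: "I \<in> injectives C" and X: "X \<in> Obj C"
    and lift: "\<And>h. h \<in> Hom C X D \<Longrightarrow> \<exists>h' \<in> Hom C X I. g \<cdot> h' = h"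
  shows "Ext1_zero C X Y"
proof -
  note S = sesD[OF s]
  have "\<exists>s \<in> Hom C X E. b \<cdot> s = Ident C X" if e: "ses a b Y E X" for E a b
  proof -
    note B = sesD[OF e]
    obtain e where e': "e \<in> Hom C E I" "e \<cdot> a = f"
      using injectivesD[OF I B(5,1) S(1)] by blast
    note obs = hom_obj[OF S(1)] hom_obj[OF S(2)] hom_obj[OF B(2)]
    note H = hom_arr[OF S(1)] hom_arr[OF S(2)] hom_arr[OF B(1)] hom_arr[OF B(2)] hom_arr[OF e'(1)]
    have "g \<cdot> e \<cdot> a = Zero C Y D"
      using H e'(2) S(7) by (simp add: arr_simps)
    then obtain t where t: "t \<in> Hom C X D" "t \<cdot> b = g \<cdot> e"
      using B(9)[OF comp_hom[OF e'(1) S(2)]] by blast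
    obtain u where u: "u \<in> Hom C X I" "g \<cdot> u = t"
      using lift[OF t(1)] by blast
    note H = H hom_arr[OF t(1)] hom_arr[OF u(1)]
    have d: "diff e (u \<cdot> b) \<in> Hom C E I"
      using H obs by (intro homI) (simp_all add: arr_simps)
    have "g \<cdot> diff e (u \<cdot> b) = Zero C E D"
      using H obs t(2) by (simp add: arr_simps comp_reduce[OF u(2)])
    then obtain r where r: "r \<in> Hom C E Y" "f \<cdot> r = diff e (u \<cdot> b)"
      using S(8)[OF d] by blast
    note H = H hom_arr[OF r(1)]
    have "f \<cdot> (r \<cdot> a) = f \<cdot> Ident C Y"
      using H obs by (simp add: arr_simps comp_reduce[OF r(2)] B(7) e'(2))
    then have "r \<cdot> a = Ident C Y"
      using monicD[OF S(5,1) comp_hom[OF B(1) r(1)] id_hom] obs by blast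
    then show ?thesis
      using section_of_retraction that r(1) by blast
  qed
  then show ?thesis
    using Ext1_zero_iff X hom_obj[OF S(1)] by blast
qed

lemma Ext1_zero_injective:
  assumes I: "I \<in> injectives C" and X: "X \<in> Obj C"
  shows "Ext1_zero C X I"
proof -
  have "\<exists>s \<in> Hom C X E. b \<cdot> s = Ident C X" if s: "ses a b I E X" for E a b
    using injectivesD[OF I sesD(5,1)[OF s] id_hom] section_of_retraction[OF s] injectives_obj[OF I]
    by blast
  then show ?thesis
    using Ext1_zero_iff X injectives_obj[OF I] by blast
qed

text \<open>Replaces exactness of \<open>Hom(I, M) -> Hom(X, M) -> Ext^1(T, M)\<close>, where
  \<open>I\<close> is an arbitrary object. The arrow \<open>p\<close> first extends to
  \<open>e\<close> with values in an injective containing \<open>M\<close>; the obstruction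
  \<open>v e\<close> to landing in \<open>M\<close> factors through \<open>T\<close>, and its lift
  is subtracted.\<close>

lemma extend_along_monic:
  assumes enough: "enough_injectives C" and s: "ses a g X I T" and z: "Ext1_zero C T M"
    and p: "p \<in> Hom C X M"
  shows "\<exists>p' \<in> Hom C I M. p' \<cdot> a = p"
proof -
  note S = sesD[OF s]
  obtain J D u v where J: "J \<in> injectives C" and uv: "ses u v M J D"
    by (rule enough_injectives_ses[OF enough hom_obj(2)[OF p]])
  note U = sesD[OF uv]
  obtain e where e: "e \<in> Hom C I J" "e \<cdot> a = u \<cdot> p"
    using injectivesD[OF J S(5,1) comp_hom[OF p U(1)]] by blast
  note obs = hom_obj[OF S(1)] hom_obj[OF S(2)] hom_obj[OF U(1)] hom_obj[OF U(2)]
  note H = hom_arr[OF S(1)] hom_arr[OF S(2)] hom_arr[OF U(1)] hom_arr[OF U(2)] hom_arr[OF e(1)]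
    hom_arr[OF p]
  have "v \<cdot> e \<cdot> a = Zero C X D"
    using H obs by (simp add: arr_simps e(2) comp_reduce[OF U(7)])
  then obtain t where t: "t \<in> Hom C T D" "t \<cdot> g = v \<cdot> e"
    using S(9)[OF comp_hom[OF e(1) U(2)]] by blast
  obtain w where w: "w \<in> Hom C T J" "v \<cdot> w = t"
    using lift_along_epic[OF uv z t(1)] by blast
  note H = H hom_arr[OF w(1)] hom_arr[OF t(1)]
  have d: "diff e (w \<cdot> g) \<in> Hom C I J"
    using H obs by (intro homI) (simp_all add: arr_simps)
  have "v \<cdot> diff e (w \<cdot> g) = Zero C I D"
    using H obs t(2) by (simp add: arr_simps comp_reduce[OF w(2)])
  then obtain r where r: "r \<in> Hom C I M" "u \<cdot> r = diff e (w \<cdot> g)"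
    using U(8)[OF d] by blast
  note H = H hom_arr[OF r(1)]
  have "u \<cdot> (r \<cdot> a) = u \<cdot> p"
    using H obs by (simp add: arr_simps comp_reduce[OF r(2)] S(7) e(2))
  then show ?thesis
    using monicD[OF U(5,1) comp_hom[OF S(1) r(1)] p] r(1) by blast
qed

text \<open>Given an extension \<open>0 \<rightarrow> X \<rightarrow> E \<rightarrow> T \<rightarrow> 0\<close>, extend \<open>X \<rightarrow> M\<close> to \<open>E \<rightarrow> M\<close>; the kernel of the latter is an
  extension of \<open>T\<close> by \<open>Y\<close>, and its section composes to a section \<open>T \<rightarrow> E\<close>.\<close>

lemma Ext1_zero_extension_right:
  assumes enough: "enough_injectives C" and s: "ses y p Y X M"
    and TY: "Ext1_zero C T Y" and TM: "Ext1_zero C T M" and T: "T \<in> Obj C"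
  shows "Ext1_zero C T X"
proof -
  note S = sesD[OF s]
  have "\<exists>s \<in> Hom C T E. b \<cdot> s = Ident C T" if e: "ses a b X E T" for E a b
  proof -
    note B = sesD[OF e]
    obtain p' where p': "p' \<in> Hom C E M" "p' \<cdot> a = p"
      using extend_along_monic[OF enough e TM S(2)] by blast
    have pe: "epic C p'"
    proof (rule epicI_zero[OF p'(1)])
      fix A u assume u: "u \<in> Hom C M A" "u \<cdot> p' = Zero C E A"
      have "u \<cdot> p = u \<cdot> p' \<cdot> a"
        using comp_assoc[OF B(1) p'(1) u(1)] p'(2) by simp
      also have "\<dots> = Zero C X A"
        using u comp_zero_left[OF B(1)] hom_obj[OF u(1)] by simp
      finally show "u = Zero C M A"
        using epicD_zero[OF S(6,2) u(1)] by blast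
    qed
    obtain k where k: "is_kernel C p' k"
      using kernel_ex p' hom_arr by blast
    define K where "K = Dom C k"
    note Kd = is_kernelD[OF k p'(1), folded K_def]
    note KC = is_cokernelD(4)[OF epic_cokernel_of_kernel[OF pe p'(1) k] Kd(1)]
    note obs = hom_obj[OF S(1)] hom_obj[OF S(2)] hom_obj[OF B(2)] hom_obj[OF Kd(1)]
    note H = hom_arr[OF S(1)] hom_arr[OF S(2)] hom_arr[OF B(1)] hom_arr[OF B(2)] hom_arr[OF p'(1)]
      hom_arr[OF Kd(1)]
    have bk: "b \<cdot> k \<in> Hom C K T"
      using comp_hom[OF Kd(1) B(2)] .
    \<comment> \<open>If \<open>u b k = 0\<close>, then \<open>u b = w p'\<close> for some
      \<open>w\<close>; restricting along \<open>a\<close> gives \<open>w p = 0\<close>, and the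
      epics \<open>p\<close> and \<open>b\<close> cancel in turn.\<close>
    have be: "epic C (b \<cdot> k)"
    proof (rule epicI_zero[OF bk])
      fix A u assume u: "u \<in> Hom C T A" "u \<cdot> (b \<cdot> k) = Zero C K A"
      note H = H hom_arr[OF u(1)] and obs = obs hom_obj[OF u(1)]
      obtain w where w: "w \<in> Hom C M A" "w \<cdot> p' = u \<cdot> b"
        using KC[OF comp_hom[OF B(2) u(1)]] comp_assoc[OF Kd(1) B(2) u(1)] u(2) H by auto
      note H = H hom_arr[OF w(1)]
      have "w \<cdot> p' \<cdot> a = Zero C X A"
        unfolding w(2) using H obs B(7) by (simp add: arr_simps)
      then have "w \<cdot> p = Zero C X A"
        using H p'(2) by (simp add: arr_simps)
      then have "w = Zero C M A"
        using epicD_zero[OF S(6,2) w(1)] by blast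
      then have "u \<cdot> b = Zero C E A"
        using w(2) comp_zero_left[OF p'(1)] obs by simp
      then show "u = Zero C T A"
        using epicD_zero[OF B(6,2) u(1)] by blast
    qed
    have ay: "a \<cdot> y \<in> Hom C Y E"
      using comp_hom[OF S(1) B(1)] .
    have "p' \<cdot> (a \<cdot> y) = Zero C Y M"
      using H S(7) by (simp add: comp_reduce[OF p'(2)])
    then obtain y' where y': "y' \<in> Hom C Y K" "k \<cdot> y' = a \<cdot> y"
      using Kd(4)[OF ay] by blast
    note H = H hom_arr[OF y'(1)]
    have bky: "b \<cdot> k \<cdot> y' = Zero C Y T"
      using H obs by (simp add: arr_simps y'(2) comp_reduce[OF B(7)])
    have aym: "monic C (a \<cdot> y)"
      using monic_comp[OF S(5) B(5) S(1) B(1)] .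
    have ym: "monic C y'"
    proof (rule monicI_zero[OF y'(1)])
      fix A u assume u: "u \<in> Hom C A Y" "y' \<cdot> u = Zero C A K"
      have "a \<cdot> y \<cdot> u = Zero C A E"
        using comp_assoc[OF u(1) y'(1) Kd(1)] y'(2) u comp_zero_right[OF Kd(1)] hom_obj[OF u(1)] by simp
      then show "u = Zero C A Y"
        using monicD_zero[OF aym ay u(1)] by blast
    qed
    \<comment> \<open>Whatever \<open>b\<close> kills inside the kernel of \<open>p'\<close> comes
      from \<open>X\<close> and dies under \<open>p\<close>, hence comes from
      \<open>Y\<close>.\<close>
    have "is_kernel C (b \<cdot> k) y'"
    proof (rule is_kernelI[OF bk y'(1) bky ym])
      fix A z assume z: "z \<in> Hom C A K" "b \<cdot> k \<cdot> z = Zero C A T"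
      note H = H hom_arr[OF z(1)] and obs = obs hom_obj[OF z(1)]
      have "b \<cdot> (k \<cdot> z) = Zero C A T"
        using z(2) H by (simp add: arr_simps)
      then obtain x where x: "x \<in> Hom C A X" "a \<cdot> x = k \<cdot> z"
        using B(8)[OF comp_hom[OF z(1) Kd(1)]] by blast
      note H = H hom_arr[OF x(1)]
      have "p \<cdot> x = p' \<cdot> (a \<cdot> x)"
        using H by (simp add: comp_reduce[OF p'(2)])
      also have "\<dots> = Zero C A M"
        unfolding x(2) using H obs by (simp add: comp_reduce[OF Kd(2)] arr_simps)
      finally obtain v where v: "v \<in> Hom C A Y" "y \<cdot> v = x"
        using S(8)[OF x(1)] by blast
      have "k \<cdot> (y' \<cdot> v) = k \<cdot> z"
        using H hom_arr[OF v(1)] by (simp add: comp_reduce[OF y'(2)] arr_simps v(2) x(2))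
      then have "y' \<cdot> v = z"
        using monicD[OF Kd(3,1) comp_hom[OF v(1) y'(1)] z(1)] by blast
      then show "\<exists>u \<in> Hom C A Y. y' \<cdot> u = z"
        using v by blast
    qed
    then have "ses y' (b \<cdot> k) Y K T"
      using sesI[OF y'(1) bk _ be] by blast
    then obtain s where s: "s \<in> Hom C T K" "b \<cdot> k \<cdot> s = Ident C T"
      using TY Ext1_zero_iff[OF T] obs by blast
    then show ?thesis
      using comp_assoc[OF s(1) Kd(1) B(2)] comp_hom[OF s(1) Kd(1)] by metis
  qed
  then show ?thesis
    using Ext1_zero_iff T hom_obj[OF S(1)] by blast
qed

section \<open>Closure properties of vanishing in the first argument\<close>

lemma Ext1_zero_retract_left:
  assumes enough: "enough_injectives C" and z: "Ext1_zero C L Y" and Y: "Y \<in> Obj C"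
    and i: "i \<in> Hom C K L" "p \<in> Hom C L K" "p \<cdot> i = Ident C K"
  shows "Ext1_zero C K Y"
proof -
  obtain I D f g where I: "I \<in> injectives C" and s: "ses f g Y I D"
    by (rule enough_injectives_ses[OF enough Y])
  note S = sesD[OF s]
  show ?thesis
  proof (rule Ext1_zeroI_lift[OF s I hom_obj(1)[OF i(1)]])
    fix h assume h: "h \<in> Hom C K D"
    obtain w where w: "w \<in> Hom C L I" "g \<cdot> w = h \<cdot> p"
      using lift_along_epic[OF s z comp_hom[OF i(2) h]] by blast
    have "g \<cdot> (w \<cdot> i) = h"
      using comp_assoc[OF i(1) w(1) S(2)] w(2) comp_assoc[OF i(1,2) h] i(3) comp_id_right[OF h]
      by simp
    then show "\<exists>h' \<in> Hom C K I. g \<cdot> h' = h"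
      using comp_hom[OF i(1) w(1)] by blast
  qed
qed

text \<open>A lift on \<open>K\<close> extends to \<open>h\<close> on \<open>L\<close> because
  \<open>I\<close> is injective. The error \<open>t - g h\<close> vanishes on \<open>K\<close>, so
  it comes from \<open>N\<close>, where it lifts too.\<close>

lemma Ext1_zero_extension_left:
  assumes enough: "enough_injectives C" and kn: "ses k n K L N" and Y: "Y \<in> Obj C"
    and KY: "Ext1_zero C K Y" and NY: "Ext1_zero C N Y"
  shows "Ext1_zero C L Y"
proof -
  note N = sesD[OF kn]
  obtain I D f g where I: "I \<in> injectives C" and s: "ses f g Y I D"
    by (rule enough_injectives_ses[OF enough Y])
  note S = sesD[OF s]
  show ?thesis
  proof (rule Ext1_zeroI_lift[OF s I hom_obj(2)[OF N(1)]])
    fix t assume t: "t \<in> Hom C L D"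
    obtain l where l: "l \<in> Hom C K I" "g \<cdot> l = t \<cdot> k"
      using lift_along_epic[OF s KY comp_hom[OF N(1) t]] by blast
    obtain h where h: "h \<in> Hom C L I" "h \<cdot> k = l"
      using injectivesD[OF I N(5,1) l(1)] by blast
    note obs = hom_obj[OF S(1)] hom_obj[OF S(2)] hom_obj[OF N(1)]
    note H = hom_arr[OF S(1)] hom_arr[OF S(2)] hom_arr[OF N(1)] hom_arr[OF N(2)] hom_arr[OF t]
      hom_arr[OF h(1)]
    have d: "diff t (g \<cdot> h) \<in> Hom C L D"
      using H obs by (intro homI) (simp_all add: arr_simps)
    have "diff t (g \<cdot> h) \<cdot> k = Zero C K D"
      using H obs l(2) by (simp add: arr_simps h(2))
    then obtain w where w: "w \<in> Hom C N D" "w \<cdot> n = diff t (g \<cdot> h)"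
      using N(9)[OF d] by blast
    obtain v where v: "v \<in> Hom C N I" "g \<cdot> v = w"
      using lift_along_epic[OF s NY w(1)] by blast
    note H = H hom_arr[OF w(1)] hom_arr[OF v(1)]
    have "g \<cdot> Plus C (v \<cdot> n) h = Plus C (diff t (g \<cdot> h)) (g \<cdot> h)"
      using H obs by (simp add: arr_simps comp_reduce[OF v(2)] w(2))
    then have "g \<cdot> Plus C (v \<cdot> n) h = t"
      using diff_plus[OF t comp_hom[OF h(1) S(2)]] by simp
    moreover have "Plus C (v \<cdot> n) h \<in> Hom C L I"
      using H obs by (intro homI) (simp_all add: arr_simps)
    ultimately show "\<exists>h' \<in> Hom C L I. g \<cdot> h' = t"
      by blast
  qed
qed

text \<open>Dimension shifting: \<open>Ext^1(N, D)\<close> stands in for \<open>Ext^2(N, Y)\<close>,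
  the term after \<open>Ext^1(K, Y)\<close> in the long exact sequence. An arrow
  \<open>K -> D\<close> extends to \<open>L\<close> and is lifted there.\<close>

lemma Ext1_zero_kernel_left:
  assumes enough: "enough_injectives C" and kn: "ses k n K L N"
    and s: "ses f g Y I D" and I: "I \<in> injectives C"
    and LY: "Ext1_zero C L Y" and ND: "Ext1_zero C N D"
  shows "Ext1_zero C K Y"
proof -
  note N = sesD[OF kn] and S = sesD[OF s]
  show ?thesis
  proof (rule Ext1_zeroI_lift[OF s I hom_obj(1)[OF N(1)]])
    fix t assume t: "t \<in> Hom C K D"
    obtain e where e: "e \<in> Hom C L D" "e \<cdot> k = t"
      using extend_along_monic[OF enough kn ND t] by blast
    obtain h where h: "h \<in> Hom C L I" "g \<cdot> h = e"
      using lift_along_epic[OF s LY e(1)] by blast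
    have "g \<cdot> (h \<cdot> k) = t"
      using comp_assoc[OF N(1) h(1) S(2)] h(2) e(2) by simp
    then show "\<exists>h' \<in> Hom C K I. g \<cdot> h' = t"
      using comp_hom[OF N(1) h(1)] by blast
  qed
qed

text \<open>Since \<open>Ext^1(K, Y') = 0\<close>, arrows \<open>K -> Y\<close> lift to the
  injective \<open>J\<close> and so extend over \<open>L\<close>. Thus \<open>Hom(K, Y)\<close>
  contributes nothing to \<open>Ext^1(N, Y)\<close>, and the vanishing of \<open>Ext^1(L, Y)\<close>
  does the rest.\<close>

lemma Ext1_zero_cokernel_left:
  assumes enough: "enough_injectives C" and kn: "ses k n K L N"
    and q: "ses j q Y' J Y" and J: "J \<in> injectives C"
    and LY: "Ext1_zero C L Y" and KY: "Ext1_zero C K Y'"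
  shows "Ext1_zero C N Y"
proof -
  note N = sesD[OF kn] and Q = sesD[OF q]
  obtain I D f g where I: "I \<in> injectives C" and s: "ses f g Y I D"
    by (rule enough_injectives_ses[OF enough hom_obj(2)[OF Q(2)]])
  note S = sesD[OF s]
  have ext: "\<exists>e \<in> Hom C L Y. e \<cdot> k = t" if t: "t \<in> Hom C K Y" for t
  proof -
    obtain l where l: "l \<in> Hom C K J" "q \<cdot> l = t"
      using lift_along_epic[OF q KY t] by blast
    obtain m where m: "m \<in> Hom C L J" "m \<cdot> k = l"
      using injectivesD[OF J N(5,1) l(1)] by blast
    have "q \<cdot> m \<cdot> k = t"
      using comp_assoc[OF N(1) m(1) Q(2)] m(2) l(2) by simp
    then show ?thesis
      using comp_hom[OF m(1) Q(2)] by blast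
  qed
  show ?thesis
  proof (rule Ext1_zeroI_lift[OF s I hom_obj(2)[OF N(2)]])
    fix t assume t: "t \<in> Hom C N D"
    obtain h where h: "h \<in> Hom C L I" "g \<cdot> h = t \<cdot> n"
      using lift_along_epic[OF s LY comp_hom[OF N(2) t]] by blast
    note obs = hom_obj[OF S(1)] hom_obj[OF S(2)] hom_obj[OF N(1)] hom_obj[OF N(2)]
    note H = hom_arr[OF S(1)] hom_arr[OF S(2)] hom_arr[OF N(1)] hom_arr[OF N(2)] hom_arr[OF t]
      hom_arr[OF h(1)]
    have "g \<cdot> (h \<cdot> k) = Zero C K D"
      using H obs by (simp add: comp_reduce[OF h(2)] arr_simps N(7))
    then obtain c where c: "c \<in> Hom C K Y" "f \<cdot> c = h \<cdot> k"
      using S(8)[OF comp_hom[OF N(1) h(1)]] by blast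
    \<comment> \<open>On \<open>K\<close> the lift \<open>h\<close> takes values in
      \<open>Y\<close>. Extending this part over \<open>L\<close> and subtracting it leaves a lift
      that descends to \<open>N\<close>.\<close>
    obtain e where e: "e \<in> Hom C L Y" "e \<cdot> k = c"
      using ext[OF c(1)] by blast
    note H = H hom_arr[OF e(1)]
    have d: "diff h (f \<cdot> e) \<in> Hom C L I"
      using H obs by (intro homI) (simp_all add: arr_simps)
    have "diff h (f \<cdot> e) \<cdot> k = Zero C K I"
      using H obs by (simp add: arr_simps e(2) c(2))
    then obtain v where v: "v \<in> Hom C N I" "v \<cdot> n = diff h (f \<cdot> e)"
      using N(9)[OF d] by blast
    note H = H hom_arr[OF v(1)]
    have "g \<cdot> v \<cdot> n = t \<cdot> n"
      using H obs by (simp add: arr_simps v(2) h(2) comp_reduce[OF S(7)])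
    then have "g \<cdot> v = t"
      using epicD[OF N(6,2) comp_hom[OF v(1) S(2)] t] by blast
    then show "\<exists>h' \<in> Hom C N I. g \<cdot> h' = t"
      using v by blast
  qed
qed

text \<open>The arrow \<open>K \<rightarrow> D\<close> induced by \<open>x\<close> lifts to \<open>K \<rightarrow> I\<close>, which extends to \<open>X \<rightarrow> I\<close>; the composite
  \<open>X \<rightarrow> I \<rightarrow> D\<close> kills \<open>Y\<close> and so factors through a retraction \<open>E \<rightarrow> D\<close>.\<close>

lemma cosyzygy_split:
  assumes enough: "enough_injectives C" and s: "ses f g M I D" and I: "I \<in> injectives C"
    and ab: "ses a b D E W" and yx: "ses y x Y X E" and kx: "ses k (b \<cdot> x) K X W"
    and KM: "Ext1_zero C K M"
  shows "\<exists>s \<in> Hom C W E. b \<cdot> s = Ident C W"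
proof -
  note S = sesD[OF s] and B = sesD[OF ab] and X = sesD[OF yx] and K = sesD[OF kx]
  note obs = hom_obj[OF S(1)] hom_obj[OF S(2)] hom_obj[OF B(2)] hom_obj[OF X(1)] hom_obj[OF X(2)]
    hom_obj[OF K(1)]
  note H = hom_arr[OF S(1)] hom_arr[OF S(2)] hom_arr[OF B(1)] hom_arr[OF B(2)] hom_arr[OF X(1)]
    hom_arr[OF X(2)] hom_arr[OF K(1)]
  have "b \<cdot> x \<cdot> y = Zero C Y W"
    using H obs by (simp add: arr_simps X(7))
  then obtain y' where y': "y' \<in> Hom C Y K" "k \<cdot> y' = y"
    using K(8)[OF X(1)] by blast
  have "b \<cdot> (x \<cdot> k) = Zero C K W"
    using H K(7) by (simp add: arr_simps)
  then obtain c where c: "c \<in> Hom C K D" "a \<cdot> c = x \<cdot> k"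
    using B(8)[OF comp_hom[OF K(1) X(2)]] by blast
  note H = H hom_arr[OF y'(1)] hom_arr[OF c(1)]
  \<comment> \<open>The arrow \<open>c\<close> is the restriction of \<open>x\<close> to
    \<open>K -> D\<close>. For a test arrow \<open>u\<close> killing \<open>c\<close>, embed its
    codomain in an injective and extend to \<open>w\<close> on \<open>E\<close>; then
    \<open>w x\<close> kills \<open>K\<close>, so \<open>w\<close> factors through \<open>b\<close>
    and vanishes on \<open>D\<close>.\<close>
  have ce: "epic C c"
  proof (rule epicI_zero[OF c(1)])
    fix U u assume u: "u \<in> Hom C D U" "u \<cdot> c = Zero C K U"
    obtain J j where J: "J \<in> injectives C" and j: "j \<in> Hom C U J" "monic C j"
      using enough hom_obj(2)[OF u(1)] unfolding enough_injectives_def by blast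
    obtain w where w: "w \<in> Hom C E J" "w \<cdot> a = j \<cdot> u"
      using injectivesD[OF J B(5,1) comp_hom[OF u(1) j(1)]] by blast
    note H = H hom_arr[OF u(1)] hom_arr[OF j(1)] hom_arr[OF w(1)] and obs = obs hom_obj[OF j(1)]
    have "w \<cdot> x \<cdot> k = w \<cdot> (a \<cdot> c)"
      unfolding c(2) using H by (simp add: arr_simps)
    also have "\<dots> = Zero C K J"
      using H obs u(2) by (simp add: comp_reduce[OF w(2)] arr_simps)
    finally obtain v where v: "v \<in> Hom C W J" "v \<cdot> (b \<cdot> x) = w \<cdot> x"
      using K(9)[OF comp_hom[OF X(2) w(1)]] by blast
    note H = H hom_arr[OF v(1)]
    have "v \<cdot> b = w"
      using epicD[OF X(6,2) comp_hom[OF B(2) v(1)] w(1)] v(2) H by (simp add: arr_simps)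
    then have "w \<cdot> a = Zero C D J"
      using H obs B(7) by (auto simp: arr_simps)
    then show "u = Zero C D U"
      using monicD_zero[OF j(2,1) u(1)] w(2) by simp
  qed
  obtain l where l: "l \<in> Hom C K I" "g \<cdot> l = c"
    using lift_along_epic[OF s KM c(1)] by blast
  obtain m where m: "m \<in> Hom C X I" "m \<cdot> k = l"
    using injectivesD[OF I K(5,1) l(1)] by blast
  note H = H hom_arr[OF l(1)] hom_arr[OF m(1)]
  have "a \<cdot> (c \<cdot> y') = Zero C Y E"
    using H by (simp add: comp_reduce[OF c(2)] arr_simps y'(2) X(7))
  then have cy: "c \<cdot> y' = Zero C Y D"
    using monicD_zero[OF B(5,1) comp_hom[OF y'(1) c(1)]] by blast
  have "g \<cdot> m \<cdot> (k \<cdot> y') = Zero C Y D"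
    using H cy by (simp add: arr_simps comp_reduce[OF m(2)] comp_reduce[OF l(2)] del: y'(2))
  then obtain r where r: "r \<in> Hom C E D" "r \<cdot> x = g \<cdot> m"
    using X(9)[OF comp_hom[OF m(1) S(2)]] y'(2) by auto
  note H = H hom_arr[OF r(1)]
  \<comment> \<open>The chain is \<open>r a c = r x k = g m k = g l = c\<close>; the epic
    \<open>c\<close> then cancels.\<close>
  have "r \<cdot> a \<cdot> c = Ident C D \<cdot> c"
    using H obs by (simp add: arr_simps c(2) comp_reduce[OF r(2)] m(2) l(2))
  then have "r \<cdot> a = Ident C D"
    using epicD[OF ce c(1) comp_hom[OF B(1) r(1)] id_hom] obs by blast
  then show ?thesis
    using section_of_retraction[OF ab r(1)] by blast
qed

end


section \<open>Gorenstein injective objects and spliced short exact sequences\<close>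

lemma int_indexed_chain:
  assumes "x \<in> G" "\<And>a. a \<in> G \<Longrightarrow> \<exists>b \<in> G. R a b" "\<And>a. a \<in> G \<Longrightarrow> \<exists>b \<in> G. R b a"
  obtains m :: "int \<Rightarrow> 'a" where "m 0 = x" "\<And>n. m n \<in> G" "\<And>n. R (m n) (m (n - 1))"
proof -
  obtain g h where g: "\<And>a. a \<in> G \<Longrightarrow> g a \<in> G \<and> R a (g a)" and h: "\<And>a. a \<in> G \<Longrightarrow> h a \<in> G \<and> R (h a) a"
    using assms(2,3) by metis
  define r l where "r n = (g ^^ n) x" and "l n = (h ^^ n) x" for n
  have rG: "r n \<in> G" and lG: "l n \<in> G" for n
    by (induction n) (simp_all add: r_def l_def assms(1) g h)
  have r: "r 0 = x" "R (r n) (r (Suc n))" for n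
    using g[OF rG[of n]] by (simp_all add: r_def)
  have l: "l 0 = x" "R (l (Suc n)) (l n)" for n
    using h[OF lG[of n]] by (simp_all add: l_def)
  \<comment> \<open>Since \<open>R\<close> relates an index to the next lower one, successors fill
    the nonpositive indices and predecessors the positive ones; both iterations start at
    \<open>x\<close>.\<close>
  define m where "m n = (if n \<le> 0 then r (nat (- n)) else l (nat n))" for n
  have "R (m n) (m (n - 1))" for n
  proof (cases "n \<le> 0")
    case True
    then have "nat (- (n - 1)) = Suc (nat (- n))"
      by simp
    then show ?thesis
      using True r(2)[of "nat (- n)"] by (simp add: m_def)
  next
    case False
    then have "nat n = Suc (nat (n - 1))"
      by simp
    then have "R (l (nat n)) (l (nat (n - 1)))"
      using l(2)[of "nat (n - 1)"] by simp
    then show ?thesis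
      using False l(1) r(1) by (cases "n = 1") (auto simp: m_def)
  qed
  moreover have "m 0 = x" "m n \<in> G" for n
    using r(1) rG lG by (simp_all add: m_def)
  ultimately show ?thesis
    using that by blast
qed

section \<open>Splicing sequences into complexes and cutting complexes into sequences\<close>

context abelian_category
begin

text \<open>By \<open>gorenstein_injectivesD\<close> the Gorenstein injectives themselves satisfy
  these closure conditions, so they form the largest such class; hence the coinductive form.\<close>

lemma gorenstein_injectives_coinduct:
  assumes M: "M \<in> G" and ext: "\<And>I N. I \<in> injectives C \<Longrightarrow> N \<in> G \<Longrightarrow> Ext1_zero C I N"
    and right: "\<And>N. N \<in> G \<Longrightarrow> \<exists>N' \<in> G. \<exists>J \<in> injectives C. \<exists>k p. ses k p N J N'"
    and left: "\<And>N. N \<in> G \<Longrightarrow> \<exists>N' \<in> G. \<exists>J \<in> injectives C. \<exists>k p. ses k p N' J N"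
  shows "M \<in> gorenstein_injectives C"
proof -
  define R where "R N N' \<longleftrightarrow> (\<exists>J \<in> injectives C. \<exists>k p. ses k p N J N')" for N N'
  obtain m where m: "m 0 = M" "\<And>n::int. m n \<in> G" "\<And>n. R (m n) (m (n - 1))"
    by (rule int_indexed_chain[of M G R]) (use M right left in \<open>auto simp: R_def\<close>)
  then have "\<forall>n. \<exists>J k p. J \<in> injectives C \<and> ses k p (m n) J (m (n - 1))"
    unfolding R_def by blast
  then obtain J k p where J: "\<And>n. J n \<in> injectives C"
    and s: "\<And>n. ses (k n) (p n) (m n) (J n) (m (n - 1))"
    by metis
  note S = sesD[OF s]
  \<comment> \<open>The differential passes through \<open>m (n - 1)\<close>. As an epic followed by
    a monic, it has the kernel of \<open>p n\<close> and the cokernel of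
    \<open>k (n - 1)\<close>.\<close>
  define d where "d n = k (n - 1) \<cdot> p n" for n
  have d: "d n \<in> Hom C (J n) (J (n - 1))" for n
    unfolding d_def using comp_hom[OF S(2) S(1)] .
  have ker: "is_kernel C (d n) (k n)" for n
    unfolding d_def using kernel_comp_monic[OF S(3) S(2) S(5) S(1)] .
  have D: "Dom C (k n) = m n" for n
    using hom_arr[OF S(1)[of n]] by blast
  have "exact_at C (d (n + 1)) (d n)" for n
  proof -
    have "p (n + 1) \<in> Hom C (J (n + 1)) (m n)" "epic C (p (n + 1))"
      using S(2,6)[of "n + 1"] by simp_all
    then have "is_cokernel C (d (n + 1)) (p n)"
      unfolding d_def using cokernel_comp_epic[OF S(4)[of n] S(1)[of n]] by simp
    then show ?thesis
      using S(3) ker by (auto simp: exact_at_def is_image_def)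
  qed
  then have ex: "exact_complex C J d"
    using d J injectives_obj by (simp add: exact_complex_def)
  have "Hom_exact C I J d" if I: "I \<in> injectives C" for I
    unfolding Hom_exact_def
  proof (rule allI, rule subset_antisym; rule subsetI)
    fix n f
    assume "f \<in> {f \<in> Hom C I (J n). d n \<cdot> f = Zero C I (J (n - 1))}"
    then obtain h where h: "h \<in> Hom C I (m n)" "k n \<cdot> h = f"
      using is_kernelD(4)[OF ker d, unfolded D] by blast
    \<comment> \<open>A cycle of \<open>Hom(I, J)\<close> is an arrow into \<open>m n\<close>;
      orthogonality of \<open>I\<close> to \<open>m (n + 1)\<close> lifts it along
      \<open>p (n + 1)\<close>, so it is a boundary.\<close>
    have s': "ses (k (n + 1)) (p (n + 1)) (m (n + 1)) (J (n + 1)) (m n)"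
      using s[of "n + 1"] by simp
    obtain h' where h': "h' \<in> Hom C I (J (n + 1))" "p (n + 1) \<cdot> h' = h"
      using lift_along_epic[OF s' ext[OF I m(2)] h(1)] by blast
    have "d (n + 1) \<cdot> h' = f"
      using comp_assoc[OF h'(1) sesD(2)[OF s'] S(1)] h(2) h'(2) by (simp add: d_def)
    then show "f \<in> (\<lambda>g. d (n + 1) \<cdot> g) ` Hom C I (J (n + 1))"
      using h' by blast
  next
    fix n f
    assume "f \<in> (\<lambda>g. d (n + 1) \<cdot> g) ` Hom C I (J (n + 1))"
    then obtain h where h: "h \<in> Hom C I (J (n + 1))" "f = d (n + 1) \<cdot> h"
      by blast
    have d1: "d (n + 1) \<in> Hom C (J (n + 1)) (J n)"
      using d[of "n + 1"] by simp
    have p1: "p (n + 1) \<in> Hom C (J (n + 1)) (m n)"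
      using S(2)[of "n + 1"] by simp
    have kn: "d n \<cdot> k n = Zero C (m n) (J (n - 1))"
      using is_kernelD(2)[OF ker d] D by simp
    have f: "f = k n \<cdot> (p (n + 1) \<cdot> h)"
      unfolding h(2) using comp_assoc[OF h(1) p1 S(1)] by (simp add: d_def)
    have "d n \<cdot> f = Zero C I (J (n - 1))"
      unfolding f using comp_assoc[OF comp_hom[OF h(1) p1] S(1) d] kn
        comp_zero_left[OF comp_hom[OF h(1) p1]] injectives_obj[OF J] by simp
    then show "f \<in> {f \<in> Hom C I (J n). d n \<cdot> f = Zero C I (J (n - 1))}"
      using comp_hom[OF h(1) d1] h(2) by blast
  qed
  then show ?thesis
    using ex J ker[of 0] D[of 0] m(1) hom_obj(1)[OF S(1)[of 0]]
    unfolding gorenstein_injectives_def by blast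
qed

text \<open>The point is that \<open>d (n + 1)\<close>, viewed as an arrow \<open>p\<close> onto the
  cycles, is epic; \<open>exact_at\<close> speaks only of subobjects.\<close>

lemma exact_complex_cycles:
  assumes ex: "exact_complex C J d" and k: "is_kernel C (d n) k" and k': "is_kernel C (d (n + 1)) k'"
  obtains p where "ses k' p (Dom C k') (J (n + 1)) (Dom C k)" "k \<cdot> p = d (n + 1)"
proof -
  have d: "d n \<in> Hom C (J n) (J (n - 1))" and d1: "d (n + 1) \<in> Hom C (J (n + 1)) (J n)"
    using ex[unfolded exact_complex_def, rule_format, of n]
      ex[unfolded exact_complex_def, rule_format, of "n + 1"] by simp_all
  note K = is_kernelD[OF k d] and K' = is_kernelD[OF k' d1]
  obtain c i where ci: "is_cokernel C (d (n + 1)) c" "is_kernel C c i" "is_kernel C (d n) i"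
    using ex[unfolded exact_complex_def, rule_format, of n] by (auto simp: exact_at_def is_image_def)
  note Cd = is_cokernelD[OF ci(1) d1]
  note Ic = is_kernelD[OF ci(2) Cd(1)] and Id = is_kernelD[OF ci(3) d]
  \<comment> \<open>The witness \<open>i\<close> of exactness is some kernel of \<open>d n\<close>,
    possibly not \<open>k\<close>; since \<open>k\<close> factors through it, \<open>c\<close> kills
    \<open>k\<close> as well.\<close>
  obtain v where v: "v \<in> Hom C (Dom C k) (Dom C i)" "i \<cdot> v = k"
    using Id(4)[OF K(1,2)] by blast
  have ck: "c \<cdot> k = Zero C (Dom C k) (Cod C c)"
    using comp_assoc[OF v(1) Ic(1) Cd(1)] v(2) Ic(2) comp_zero_left[OF v(1)] hom_obj[OF Cd(1)] by simp
  obtain w where w: "w \<in> Hom C (J (n + 1)) (Dom C i)" "i \<cdot> w = d (n + 1)"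
    using Ic(4)[OF d1 Cd(2)] by blast
  have "d n \<cdot> d (n + 1) = Zero C (J (n + 1)) (J (n - 1))"
    using comp_assoc[OF w(1) Id(1) d] w(2) Id(2) comp_zero_left[OF w(1)] hom_obj[OF d] by simp
  then obtain p where p: "p \<in> Hom C (J (n + 1)) (Dom C k)" "k \<cdot> p = d (n + 1)"
    using K(4)[OF d1] by blast
  note obs = hom_obj[OF d] hom_obj[OF d1] hom_obj[OF K(1)] hom_obj[OF Cd(1)]
  \<comment> \<open>If \<open>u p = 0\<close>, then \<open>d (n + 1)\<close> factors through the
    subobject \<open>k l\<close>, where \<open>l\<close> is a kernel of \<open>u\<close>. The
    cokernel \<open>z\<close> of \<open>k l\<close> then factors through \<open>c\<close> and kills
    \<open>k\<close>, so \<open>k\<close> factors through \<open>k l\<close>. Thus \<open>l\<close>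
    has a right inverse and \<open>u = 0\<close>.\<close>
  have "epic C p"
  proof (rule epicI_zero[OF p(1)])
    fix Q u assume u: "u \<in> Hom C (Dom C k) Q" "u \<cdot> p = Zero C (J (n + 1)) Q"
    obtain l where l: "is_kernel C u l"
      using kernel_ex u hom_arr by blast
    note L = is_kernelD[OF l u(1)]
    obtain t where t: "t \<in> Hom C (J (n + 1)) (Dom C l)" "l \<cdot> t = p"
      using L(4)[OF p(1) u(2)] by blast
    have kl: "k \<cdot> l \<in> Hom C (Dom C l) (J n)"
      using comp_hom[OF L(1) K(1)] .
    have klm: "monic C (k \<cdot> l)"
      using monic_comp[OF L(3) K(3) L(1) K(1)] .
    then obtain z where z: "is_cokernel C (k \<cdot> l) z"
      using cokernel_ex kl hom_arr by blast
    note Z = is_cokernelD[OF z kl]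
    have zk: "is_kernel C z (k \<cdot> l)"
      by (rule monic_kernel_of_cokernel[OF klm kl z])
    note H = hom_arr[OF K(1)] hom_arr[OF L(1)] hom_arr[OF t(1)] hom_arr[OF p(1)] hom_arr[OF Z(1)]
      hom_arr[OF Cd(1)]
    note obs = obs hom_obj[OF Z(1)] hom_obj[OF t(1)]
    have "z \<cdot> d (n + 1) = z \<cdot> (k \<cdot> l \<cdot> t)"
      using H by (simp add: arr_simps p(2)[symmetric] t(2))
    also have "\<dots> = Zero C (J (n + 1)) (Cod C z)"
      using comp_assoc[OF t(1) kl Z(1)] Z(2) comp_zero_left[OF t(1)] obs by simp
    finally obtain z' where z': "z' \<in> Hom C (Cod C c) (Cod C z)" "z' \<cdot> c = z"
      using Cd(4)[OF Z(1)] by blast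
    have "z \<cdot> k = Zero C (Dom C k) (Cod C z)"
      using comp_assoc[OF K(1) Cd(1) z'(1)] z'(2) ck comp_zero_right[OF z'(1)] obs by simp
    then obtain x where x: "x \<in> Hom C (Dom C k) (Dom C l)" "k \<cdot> l \<cdot> x = k"
      using is_kernelD(4)[OF zk Z(1) K(1)] hom_arr[OF kl] by auto
    have "k \<cdot> (l \<cdot> x) = k \<cdot> Ident C (Dom C k)"
      using x(2) comp_assoc[OF x(1) L(1) K(1)] comp_id_right[OF K(1)] by simp
    then have "l \<cdot> x = Ident C (Dom C k)"
      using monicD[OF K(3,1) comp_hom[OF x(1) L(1)] id_hom] obs by blast
    then have "u = u \<cdot> l \<cdot> x"
      using comp_assoc[OF x(1) L(1) u(1)] comp_id_right[OF u(1)] by simp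
    then show "u = Zero C (Dom C k) Q"
      using L(2) comp_zero_left[OF x(1)] hom_obj[OF u(1)] by simp
  qed
  moreover have "is_kernel C p k'"
  proof (rule is_kernelI[OF p(1) K'(1) _ K'(3)])
    have "k \<cdot> (p \<cdot> k') = Zero C (Dom C k') (J n)"
      using comp_assoc[OF K'(1) p(1) K(1)] p(2) K'(2) by simp
    then show "p \<cdot> k' = Zero C (Dom C k') (Dom C k)"
      using monicD_zero[OF K(3,1) comp_hom[OF K'(1) p(1)]] by blast
    fix A h assume h: "h \<in> Hom C A (J (n + 1))" "p \<cdot> h = Zero C A (Dom C k)"
    then have "d (n + 1) \<cdot> h = Zero C A (J n)"
      using comp_assoc[OF h(1) p(1) K(1)] p(2) comp_zero_right[OF K(1)] hom_obj[OF h(1)] by simp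
    then show "\<exists>u \<in> Hom C A (Dom C k'). k' \<cdot> u = h"
      using K'(4)[OF h(1)] by blast
  qed
  ultimately show ?thesis
    using sesI[OF K'(1) p(1)] p(2) that by blast
qed

text \<open>The definition fixes degree 0, so the complex is reindexed by \<open>n\<close>, with no
  change of sign in the differentials.\<close>

lemma cycles_gorenstein_injective:
  assumes ex: "exact_complex C J d" and J: "\<And>n. J n \<in> injectives C"
    and hom: "\<And>I. I \<in> injectives C \<Longrightarrow> Hom_exact C I J d" and k: "is_kernel C (d n) k"
  shows "Dom C k \<in> gorenstein_injectives C"
proof -
  define J' d' where "J' i = J (i + n)" and "d' i = d (i + n)" for i
  have "exact_complex C J' d'"
    unfolding exact_complex_def
  proof
    fix i
    show "J' i \<in> Obj C \<and> d' i \<in> Hom C (J' i) (J' (i - 1)) \<and> exact_at C (d' (i + 1)) (d' i)"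
      using ex[unfolded exact_complex_def, rule_format, of "i + n"]
      by (simp add: J'_def d'_def algebra_simps)
  qed
  moreover have "Hom_exact C I J' d'" if "I \<in> injectives C" for I
    unfolding Hom_exact_def
  proof
    fix i
    show "{f \<in> Hom C I (J' i). d' i \<cdot> f = Zero C I (J' (i - 1))}
        = (\<lambda>g. d' (i + 1) \<cdot> g) ` Hom C I (J' (i + 1))"
      using hom[OF that, unfolded Hom_exact_def, rule_format, of "i + n"]
      by (simp add: J'_def d'_def algebra_simps)
  qed
  moreover have "is_kernel C (d' 0) k" "J' i \<in> injectives C" for i
    using k J by (simp_all add: d'_def J'_def)
  moreover have "Dom C k \<in> Obj C"
    using k dom_obj by (auto simp: is_kernel_def)
  ultimately show ?thesis
    unfolding gorenstein_injectives_def by blast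
qed

text \<open>With \<open>M\<close> the cycles in degree 0, the neighbours of \<open>M\<close> are the
  cycles in degrees -1 and 1.\<close>

lemma gorenstein_injectivesD:
  assumes M: "M \<in> gorenstein_injectives C"
  shows "\<exists>N \<in> gorenstein_injectives C. \<exists>J \<in> injectives C. \<exists>k p. ses k p M J N"
    and "\<exists>N \<in> gorenstein_injectives C. \<exists>J \<in> injectives C. \<exists>k p. ses k p N J M"
    and "\<And>I. I \<in> injectives C \<Longrightarrow> Ext1_zero C I M"
proof -
  obtain J d k where ex: "exact_complex C J d" and J: "\<And>n. J n \<in> injectives C"
    and hom: "\<And>I. I \<in> injectives C \<Longrightarrow> Hom_exact C I J d"
    and k: "is_kernel C (d 0) k" "Dom C k = M"
    using M unfolding gorenstein_injectives_def by blast
  have d: "d n \<in> Hom C (J n) (J (n - 1))" for n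
    using ex by (simp add: exact_complex_def)
  obtain k1 km where k1: "is_kernel C (d 1) k1" and km: "is_kernel C (d (- 1)) km"
    using kernel_ex d hom_arr by metis
  have GI: "Dom C i \<in> gorenstein_injectives C" if "is_kernel C (d n) i" for n i
    using cycles_gorenstein_injective[OF ex J _ that] hom by blast
  obtain p where p: "ses k p M (J 0) (Dom C km)" "km \<cdot> p = d 0"
    by (rule exact_complex_cycles[OF ex km, of k]) (use k in auto)
  then show "\<exists>N \<in> gorenstein_injectives C. \<exists>J \<in> injectives C. \<exists>k p. ses k p M J N"
    using GI[OF km] J by blast
  obtain p1 where "ses k1 p1 (Dom C k1) (J 1) M"
    by (rule exact_complex_cycles[OF ex k(1), of k1]) (use k1 k(2) in auto)
  then show "\<exists>N \<in> gorenstein_injectives C. \<exists>J \<in> injectives C. \<exists>k p. ses k p N J M"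
    using GI[OF k1] J by blast
  fix I assume I: "I \<in> injectives C"
  note P = sesD[OF p(1)] and KM = is_kernelD[OF km d]
  have KM1: "km \<in> Hom C (Dom C km) (J (- 1))"
    using KM(1) by simp
  show "Ext1_zero C I M"
  \<comment> \<open>An arrow from \<open>I\<close> into the cycles of degree -1 becomes, after
    \<open>km\<close>, a cycle of \<open>Hom(I, J)\<close>, hence a boundary; cancelling the monic
    \<open>km\<close> gives the lift along \<open>p\<close>.\<close>
  proof (rule Ext1_zeroI_lift[OF p(1) J injectives_obj[OF I]])
    fix h assume h: "h \<in> Hom C I (Dom C km)"
    have "d (- 1) \<cdot> (km \<cdot> h) = Zero C I (J (- 1 - 1))"
      using comp_assoc[OF h KM(1) d] KM(2) comp_zero_left[OF h] injectives_obj[OF J] by simp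
    then have "km \<cdot> h \<in> (\<lambda>g. d (- 1 + 1) \<cdot> g) ` Hom C I (J (- 1 + 1))"
      using hom[OF I, unfolded Hom_exact_def, rule_format, of "- 1"] comp_hom[OF h KM1] by blast
    then obtain g where g: "g \<in> Hom C I (J 0)" "km \<cdot> h = d 0 \<cdot> g"
      by auto
    then have "km \<cdot> (p \<cdot> g) = km \<cdot> h"
      using comp_assoc[OF g(1) P(2) KM1] p(2) by simp
    then have "p \<cdot> g = h"
      using monicD[OF KM(3) KM1 comp_hom[OF g(1) P(2)] h] by blast
    then show "\<exists>h' \<in> Hom C I (J 0). p \<cdot> h' = h"
      using g(1) by blast
  qed
qed

end

section \<open>Injective cotorsion pairs\<close>

context abelian_category
begin

lemma cotorsion_pairD:
  assumes "cotorsion_pair C \<W> \<F>"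
  shows "X \<in> \<W> \<Longrightarrow> X \<in> Obj C" "Y \<in> \<F> \<Longrightarrow> Y \<in> Obj C"
    "X \<in> \<W> \<Longrightarrow> Y \<in> \<F> \<Longrightarrow> Ext1_zero C X Y"
    "X \<in> Obj C \<Longrightarrow> (\<And>Y. Y \<in> \<F> \<Longrightarrow> Ext1_zero C X Y) \<Longrightarrow> X \<in> \<W>"
    "Y \<in> Obj C \<Longrightarrow> (\<And>X. X \<in> \<W> \<Longrightarrow> Ext1_zero C X Y) \<Longrightarrow> Y \<in> \<F>"
  using assms unfolding cotorsion_pair_def left_perp_def right_perp_def by blast+

lemma injective_cotorsion_pair_gorenstein:
  assumes enough: "enough_injectives C" and icp: "injective_cotorsion_pair C \<W> \<F>"
  shows "\<F> \<subseteq> gorenstein_injectives C"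
proof
  have cp: "cotorsion_pair C \<W> \<F>" and th: "thick C \<W>" and wf: "\<W> \<inter> \<F> = injectives C"
    using icp by (simp_all add: injective_cotorsion_pair_def complete_cotorsion_pair_def)
  note P = cotorsion_pairD[OF cp]
  have approx: "\<exists>X \<in> \<W>. \<exists>Y \<in> \<F>. \<exists>f g. ses f g Y X B" if "B \<in> Obj C" for B
    using icp that unfolding injective_cotorsion_pair_def complete_cotorsion_pair_def ses_def by blast
  fix M assume "M \<in> \<F>"
  then show "M \<in> gorenstein_injectives C"
  proof (rule gorenstein_injectives_coinduct)
    show "Ext1_zero C I N" if "I \<in> injectives C" "N \<in> \<F>" for I N
      using that P(3) wf by blast
  next
    fix N assume N: "N \<in> \<F>"
    obtain I D f g where I: "I \<in> injectives C" and s: "ses f g N I D"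
      by (rule enough_injectives_ses[OF enough P(2)[OF N]])
    have D: "D \<in> Obj C"
      using hom_obj(2)[OF sesD(2)[OF s]] .
    have "D \<in> \<F>"
    proof (rule P(5)[OF D])
      fix W assume W: "W \<in> \<W>"
      \<comment> \<open>Completeness covers \<open>E\<close> by some \<open>X\<close> in
        \<open>\<W>\<close>; the kernel of the composite \<open>X -> E -> W\<close> is in
        \<open>\<W>\<close> by thickness, hence orthogonal to \<open>N\<close>, as
        \<open>cosyzygy_split\<close> demands.\<close>
      have "\<exists>s \<in> Hom C W E. b \<cdot> s = Ident C W" if ab: "ses a b D E W" for E a b
      proof -
        note B = sesD[OF ab]
        obtain X Y y x where X: "X \<in> \<W>" and yx: "ses y x Y X E"
          using approx hom_obj(2)[OF B(1)] by blast
        note S = sesD[OF yx]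
        have bx: "b \<cdot> x \<in> Hom C X W"
          using comp_hom[OF S(2) B(2)] .
        obtain k where k: "is_kernel C (b \<cdot> x) k"
          using kernel_ex bx hom_arr by blast
        have kx: "ses k (b \<cdot> x) (Dom C k) X W"
          using sesI[OF is_kernelD(1)[OF k bx] bx k] epic_comp[OF S(6) B(6) S(2) B(2)] by blast
        then have "Dom C k \<in> \<W>"
          using th X W unfolding thick_def ses_def by blast
        then show ?thesis
          using cosyzygy_split[OF enough s I ab yx kx] P(3) N by blast
      qed
      then show "Ext1_zero C W D"
        using Ext1_zero_iff[OF P(1)[OF W] D] by blast
    qed
    then show "\<exists>N' \<in> \<F>. \<exists>J \<in> injectives C. \<exists>k p. ses k p N J N'"
      using I s by blast
  next
    fix N assume N: "N \<in> \<F>"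
    obtain X Y y x where X: "X \<in> \<W>" and Y: "Y \<in> \<F>" and yx: "ses y x Y X N"
      using approx P(2)[OF N] by blast
    have "Ext1_zero C T X" if "T \<in> \<W>" for T
      using Ext1_zero_extension_right[OF enough yx] P(1,3) that Y N by blast
    then have "X \<in> injectives C"
      using P(1,5) X wf by blast
    then show "\<exists>N' \<in> \<F>. \<exists>J \<in> injectives C. \<exists>k p. ses k p N' J N"
      using Y yx by blast
  qed
qed

text \<open>To test against a Gorenstein injective \<open>Y\<close>, the cokernel case uses a
  sequence ending in \<open>Y\<close> and the kernel case one starting at \<open>Y\<close>; the
  other end is again Gorenstein injective.\<close>

lemma thick_left_perp_gorenstein:
  assumes enough: "enough_injectives C"
  shows "thick C (left_perp C (gorenstein_injectives C))"
proof -
  let ?W = "left_perp C (gorenstein_injectives C)"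
  have GO: "Y \<in> gorenstein_injectives C \<Longrightarrow> Y \<in> Obj C" for Y
    by (simp add: gorenstein_injectives_def)
  have W: "X \<in> Obj C" "Y \<in> gorenstein_injectives C \<Longrightarrow> Ext1_zero C X Y" if "X \<in> ?W" for X Y
    using that by (auto simp: left_perp_def)
  have WI: "X \<in> ?W" if "X \<in> Obj C" "\<And>Y. Y \<in> gorenstein_injectives C \<Longrightarrow> Ext1_zero C X Y" for X
    using that by (auto simp: left_perp_def)
  have "B \<in> ?W" if S: "S \<in> ?W" and "direct_summand C B S" for S B
  proof -
    obtain i p where ip: "i \<in> Hom C B S" "p \<in> Hom C S B" "p \<cdot> i = Ident C B"
      using \<open>direct_summand C B S\<close> by (auto simp: direct_summand_def is_biproduct_def)
    show ?thesis
      using Ext1_zero_retract_left[OF enough W(2)[OF S] GO ip] WI hom_obj(1)[OF ip(1)] by blast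
  qed
  moreover have "(K \<in> ?W \<and> L \<in> ?W \<longrightarrow> N \<in> ?W) \<and> (K \<in> ?W \<and> N \<in> ?W \<longrightarrow> L \<in> ?W) \<and>
      (L \<in> ?W \<and> N \<in> ?W \<longrightarrow> K \<in> ?W)" if fg: "ses f g K L N" for K L N f g
  proof (intro conjI impI)
    note obs = hom_obj[OF sesD(1)[OF fg]] hom_obj[OF sesD(2)[OF fg]]
    { assume KL: "K \<in> ?W \<and> L \<in> ?W"
      show "N \<in> ?W"
      proof (rule WI)
        fix Y assume Y: "Y \<in> gorenstein_injectives C"
        then obtain Y' J j q where "Y' \<in> gorenstein_injectives C" "J \<in> injectives C" "ses j q Y' J Y"
          using gorenstein_injectivesD(2) by blast
        then show "Ext1_zero C N Y"
          using Ext1_zero_cokernel_left[OF enough fg] KL W(2) Y by blast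
      qed (use obs in blast) }
    { assume KN: "K \<in> ?W \<and> N \<in> ?W"
      then show "L \<in> ?W"
        using WI[OF obs(2)] Ext1_zero_extension_left[OF enough fg GO] W(2) by blast }
    { assume LN: "L \<in> ?W \<and> N \<in> ?W"
      show "K \<in> ?W"
      proof (rule WI)
        fix Y assume Y: "Y \<in> gorenstein_injectives C"
        then obtain Y' J j q where "Y' \<in> gorenstein_injectives C" "J \<in> injectives C" "ses j q Y J Y'"
          using gorenstein_injectivesD(1) by blast
        then show "Ext1_zero C K Y"
          using Ext1_zero_kernel_left[OF enough fg] LN W(2) Y by blast
      qed (use obs in blast) }
  qed
  moreover have "?W \<subseteq> Obj C"
    using W by blast
  ultimately show ?thesis
    unfolding thick_def ses_def by blast
qed

lemma left_perp_gorenstein_inter: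
  assumes cp: "cotorsion_pair C (left_perp C (gorenstein_injectives C)) (gorenstein_injectives C)"
  shows "left_perp C (gorenstein_injectives C) \<inter> gorenstein_injectives C = injectives C"
proof
  note P = cotorsion_pairD[OF cp]
  show "left_perp C (gorenstein_injectives C) \<inter> gorenstein_injectives C \<subseteq> injectives C"
  proof
    fix M assume M: "M \<in> left_perp C (gorenstein_injectives C) \<inter> gorenstein_injectives C"
    then obtain N J k p where N: "N \<in> gorenstein_injectives C" and J: "J \<in> injectives C"
      and s: "ses k p N J M"
      using gorenstein_injectivesD(2) by blast
    then obtain t where "t \<in> Hom C M J" "p \<cdot> t = Ident C M"
      using M P Ext1_zero_iff[of M N] by blast
    then show "M \<in> injectives C"
      using injective_retract[OF J] sesD(2)[OF s] by blast
  qed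
  show "injectives C \<subseteq> left_perp C (gorenstein_injectives C) \<inter> gorenstein_injectives C"
  proof
    fix I assume I: "I \<in> injectives C"
    \<comment> \<open>By the cotorsion pair the Gorenstein injectives are the whole right orthogonal
      class, which contains every injective; no complex has to be exhibited.\<close>
    have "I \<in> gorenstein_injectives C"
      using P(5)[OF injectives_obj[OF I]] Ext1_zero_injective[OF I] P(1) by blast
    moreover have "I \<in> left_perp C (gorenstein_injectives C)"
      using P(4)[OF injectives_obj[OF I]] gorenstein_injectivesD(3) I by blast
    ultimately show "I \<in> left_perp C (gorenstein_injectives C) \<inter> gorenstein_injectives C"
      by blast
  qed
qed

end

theorem theorem2:
  fixes A :: "('o, 'm) additive_data"
  assumes "abelian_category A"
    and "enough_injectives A"
  shows "(\<forall>\<W> \<F>. injective_cotorsion_pair A \<W> \<F> \<longrightarrow>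
            injectives A \<subseteq> \<F> \<and> \<F> \<subseteq> gorenstein_injectives A) \<and>
         (complete_cotorsion_pair A (left_perp A (gorenstein_injectives A)) (gorenstein_injectives A) \<longrightarrow>
            injective_cotorsion_pair A (left_perp A (gorenstein_injectives A)) (gorenstein_injectives A))"
proof -
  interpret abelian_category A
    by (rule assms(1))
  show ?thesis
  proof (intro conjI allI impI)
    fix \<W> \<F>
    assume icp: "injective_cotorsion_pair A \<W> \<F>"
    then show "injectives A \<subseteq> \<F>"
      by (auto simp: injective_cotorsion_pair_def)
    show "\<F> \<subseteq> gorenstein_injectives A"
      by (rule injective_cotorsion_pair_gorenstein[OF assms(2) icp])
  next
    assume "complete_cotorsion_pair A (left_perp A (gorenstein_injectives A)) (gorenstein_injectives A)"
    then show "injective_cotorsion_pair A (left_perp A (gorenstein_injectives A)) (gorenstein_injectives A)"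
      using thick_left_perp_gorenstein[OF assms(2)] left_perp_gorenstein_inter
      by (simp add: injective_cotorsion_pair_def complete_cotorsion_pair_def)
  qed
qed

end
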